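(* If each product can transit to at most one other product in addition to the no-purchase option, i.e. for each $j\in\mathcal N$ there is at most one $i\in\mathcal N$ with $v_{ji}>0$, then the MCST problem can be solved in $O(n)$ time by the following dynamic program. Say there is a link from $j$ to $i$ if $v_{ji}>0$. Links from $j$ to $k$ with $r_j\ge r_k$ are removed, so that all remaining links from $j$ to $k$ satisfy $j>k$, i.e. $r_j<r_k$. The remaining links form a directed tree on the products, whose root is taken, without loss of generality, to be product $1$; if there is a link from $j$ to $k$, then $j$ is called a child of $k$. Let $\mathcal V(i,1)$ (respectively $\mathcal V(i,0)$) denote the optimal revenue obtainable using the products in the subtree starting from product $i$ when product $i$ is included (respectively not included) in the assortment. These values are computed from the leaves up to the root by $$\mathcal V(i,1)=\lambda_ir_i,\qquad \mathcal V(i,0)=0\qquad\text{if } i \text{ is a leaf},$$ and, if $i$ is not a leaf, $$\mathcal V(i,1)=\lambda_ir_i+\sum_{j:\ j\text{ is a child of }i}\max\left\{\mathcal V(j,1),\ \frac{\lambda_jv_{ji}r_i}{v_{ji}+v_{j0}}+\mathcal V(j,0)\right\},\qquad \mathcal V(i,0)=\sum_{j:\ j\text{ is a child of }i}\mathcal V(j,1).$$ The optimal value of the MCST problem is $\mathcal V(1,1)$.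
   Context: An instance of the MCST problem (assortment optimization under the Markov chain choice model with single transition) consists of products $\mathcal N=\{1,\dots,n\}$ with no-purchase option $0$; fixed revenues $r_j$, sorted so that $r_1\ge\cdots\ge r_n$; arrival probabilities $\lambda_j\ge0$ with $\sum_{j=1}^n\lambda_j=1$; and transition weights $v_{ji}\ge0$ for $j\in\mathcal N$, $i\in\mathcal N\cup\{0\}$ with $\sum_{i\in\mathcal N\cup\{0\}}v_{ji}=1$ for every $j$. The seller chooses an offered assortment $S\subseteq\mathcal N$ and, for each $j\in\mathcal N\setminus S$, a recommended set $R_j\subseteq S$. The MCST problem is $$\max_{S\subseteq\mathcal N,\ R_j\subseteq S\ \forall j\notin S}\ \ \sum_{i\in S}\lambda_ir_i+\sum_{j\notin S}\lambda_j\frac{\sum_{i\in R_j}r_iv_{ji}}{\sum_{i\in R_j}v_{ji}+v_{j0}},$$ with the convention $0/0=0$.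
   Formalization: Revenues are additionally assumed nonnegative (r_j ≥ 0); without this the claim fails, e.g. n=1, λ_1=1, r_1=−1, v_10=1 has optimal value 0 but V(1,1)=−1. *)

theory Defs
  imports Complex_Main "HOL-Library.Landau_Symbols"
begin

section \<open>The assortment problem\<close>

text \<open>The products are \<open>1, \<dots>, nprod I\<close>; \<open>wt I j 0\<close> is the weight of the no-purchase option.\<close>

record mcst =
  nprod :: nat
  price :: "nat \<Rightarrow> real"
  arr :: "nat \<Rightarrow> real"
  wt :: "nat \<Rightarrow> nat \<Rightarrow> real"

definition products :: "mcst \<Rightarrow> nat set" where
  "products I = {1..nprod I}"

text \<open>
  Revenues are taken to be nonnegative. This is needed for the recursion below: with
  one product of negative revenue the best assortment is empty, but the recursion offers
  the root. At least one product exists because the arrival probabilities sum to 1.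
\<close>

definition valid_mcst :: "mcst \<Rightarrow> bool" where
  "valid_mcst I \<longleftrightarrow>
     (\<forall>j\<in>products I. 0 \<le> price I j) \<and>
     (\<forall>i\<in>products I. \<forall>j\<in>products I. i \<le> j \<longrightarrow> price I j \<le> price I i) \<and>
     (\<forall>j\<in>products I. 0 \<le> arr I j) \<and>
     (\<Sum>j\<in>products I. arr I j) = 1 \<and>
     (\<forall>j\<in>products I. \<forall>i\<in>insert 0 (products I). 0 \<le> wt I j i) \<and>
     (\<forall>j\<in>products I. (\<Sum>i\<in>insert 0 (products I). wt I j i) = 1)"

definition feasible :: "nat set \<Rightarrow> nat set \<Rightarrow> (nat \<Rightarrow> nat set) \<Rightarrow> bool" where
  "feasible N S R \<longleftrightarrow> S \<subseteq> N \<and> (\<forall>j\<in>N - S. R j \<subseteq> S)"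

text \<open>
  The objective for an arbitrary product set \<open>N\<close> and arbitrary weights \<open>w\<close>, so that it also
  applies to subtrees. The convention 0/0 = 0 is built into division.
\<close>

definition revenue ::
  "mcst \<Rightarrow> nat set \<Rightarrow> (nat \<Rightarrow> nat \<Rightarrow> real) \<Rightarrow> nat set \<Rightarrow> (nat \<Rightarrow> nat set) \<Rightarrow> real" where
  "revenue I N w S R =
     (\<Sum>i\<in>S. arr I i * price I i) +
     (\<Sum>j\<in>N - S. arr I j * ((\<Sum>i\<in>R j. price I i * w j i) / ((\<Sum>i\<in>R j. w j i) + w j 0)))"

text \<open>
  Although there are infinitely many functions \<open>R\<close>, the set of values is finite for finite
  \<open>N\<close>, since only \<open>S\<close> and the values of \<open>R\<close> on \<open>N - S\<close> matter.
\<close>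

definition mcst_opt :: "mcst \<Rightarrow> real" where
  "mcst_opt I =
     Max {revenue I (products I) (wt I) S R | S R. feasible (products I) S R}"


section \<open>Single links, the forest of links and subtree optima\<close>

definition single_link :: "mcst \<Rightarrow> bool" where
  "single_link I \<longleftrightarrow> (\<forall>j\<in>products I. card {i \<in> products I. 0 < wt I j i} \<le> 1)"

text \<open>The links that remain after removing those from \<open>j\<close> to \<open>k\<close> with \<open>r\<^sub>j \<ge> r\<^sub>k\<close>.\<close>

definition links :: "mcst \<Rightarrow> (nat \<times> nat) set" where
  "links I = {(j, k). j \<in> products I \<and> k \<in> products I \<and> 0 < wt I j k \<and> price I j < price I k}"

definition children :: "mcst \<Rightarrow> nat \<Rightarrow> nat set" where
  "children I i = {j. (j, i) \<in> links I}"

definition roots :: "mcst \<Rightarrow> nat set" where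
  "roots I = {i \<in> products I. \<forall>k. (i, k) \<notin> links I}"

definition subtree :: "mcst \<Rightarrow> nat \<Rightarrow> nat set" where
  "subtree I i = {j \<in> products I. (j, i) \<in> (links I)\<^sup>*}"

definition pruned :: "mcst \<Rightarrow> nat \<Rightarrow> nat \<Rightarrow> real" where
  "pruned I j i = (if i = 0 \<or> (j, i) \<in> links I then wt I j i else 0)"

text \<open>
  \<open>subtree_opt I i True\<close> is \<open>\<V>(i,1)\<close> and \<open>subtree_opt I i False\<close> is \<open>\<V>(i,0)\<close>, defined by what
  they stand for (optimal revenue in the subtree of \<open>i\<close>, over the remaining links), not by
  the recursion.
\<close>

definition subtree_opt :: "mcst \<Rightarrow> nat \<Rightarrow> bool \<Rightarrow> real" where
  "subtree_opt I i b =
     Max {revenue I (subtree I i) (pruned I) S R | S R.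
            feasible (subtree I i) S R \<and> (i \<in> S \<longleftrightarrow> b)}"


section \<open>A random access machine with unit-cost real arithmetic\<close>

text \<open>
  Memory consists of named arrays of natural numbers and named arrays of reals; a scalar is
  the cell with index 0. Every node of an expression and every executed command costs one
  step. On natural numbers only the constants, successor, predecessor and comparison
  are available, and reals cannot be converted to indices, so that a step cannot hide a
  nonconstant amount of work.
\<close>

type_synonym vname = string

record mem =
  nmem :: "vname \<Rightarrow> nat \<Rightarrow> nat"
  rmem :: "vname \<Rightarrow> nat \<Rightarrow> real"

datatype nexp = NConst nat | NCell vname nexp | NSucc nexp | NPred nexp

datatype rexp =
  RZero | RCell vname nexp | RAdd rexp rexp | RMult rexp rexp | RDiv rexp rexp

datatype bexp = NLess nexp nexp | RLess rexp rexp | BAnd bexp bexp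

datatype com =
  NAssign vname nexp nexp
| RAssign vname nexp rexp
| Seq com com  (infixr \<open>;;\<close> 60)
| Cond bexp com com
| While bexp com

fun nval :: "nexp \<Rightarrow> mem \<Rightarrow> nat" where
  "nval (NConst n) s = n"
| "nval (NCell x e) s = nmem s x (nval e s)"
| "nval (NSucc e) s = nval e s + 1"
| "nval (NPred e) s = nval e s - 1"

fun rval :: "rexp \<Rightarrow> mem \<Rightarrow> real" where
  "rval RZero s = 0"
| "rval (RCell x e) s = rmem s x (nval e s)"
| "rval (RAdd a b) s = rval a s + rval b s"
| "rval (RMult a b) s = rval a s * rval b s"
| "rval (RDiv a b) s = rval a s / rval b s"

fun bval :: "bexp \<Rightarrow> mem \<Rightarrow> bool" where
  "bval (NLess a b) s \<longleftrightarrow> nval a s < nval b s"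
| "bval (RLess a b) s \<longleftrightarrow> rval a s < rval b s"
| "bval (BAnd a b) s \<longleftrightarrow> bval a s \<and> bval b s"

fun ncost :: "nexp \<Rightarrow> nat" where
  "ncost (NConst n) = 1"
| "ncost (NCell x e) = 1 + ncost e"
| "ncost (NSucc e) = 1 + ncost e"
| "ncost (NPred e) = 1 + ncost e"

fun rcost :: "rexp \<Rightarrow> nat" where
  "rcost RZero = 1"
| "rcost (RCell x e) = 1 + ncost e"
| "rcost (RAdd a b) = 1 + rcost a + rcost b"
| "rcost (RMult a b) = 1 + rcost a + rcost b"
| "rcost (RDiv a b) = 1 + rcost a + rcost b"

fun bcost :: "bexp \<Rightarrow> nat" where
  "bcost (NLess a b) = 1 + ncost a + ncost b"
| "bcost (RLess a b) = 1 + rcost a + rcost b"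
| "bcost (BAnd a b) = 1 + bcost a + bcost b"

text \<open>\<open>exec c s t s'\<close>: started in \<open>s\<close>, the command \<open>c\<close> terminates in \<open>s'\<close> after \<open>t\<close> steps.\<close>

inductive exec :: "com \<Rightarrow> mem \<Rightarrow> nat \<Rightarrow> mem \<Rightarrow> bool" where
  NAssign: "exec (NAssign x e a) s (1 + ncost e + ncost a)
     (s\<lparr>nmem := (nmem s)(x := (nmem s x)(nval e s := nval a s))\<rparr>)"
| RAssign: "exec (RAssign x e a) s (1 + ncost e + rcost a)
     (s\<lparr>rmem := (rmem s)(x := (rmem s x)(nval e s := rval a s))\<rparr>)"
| Seq: "exec c s t s' \<Longrightarrow> exec d s' u s'' \<Longrightarrow> exec (c ;; d) s (1 + t + u) s''"
| CondTrue: "bval b s \<Longrightarrow> exec c s t s' \<Longrightarrow> exec (Cond b c d) s (1 + bcost b + t) s'"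
| CondFalse: "\<not> bval b s \<Longrightarrow> exec d s t s' \<Longrightarrow> exec (Cond b c d) s (1 + bcost b + t) s'"
| WhileFalse: "\<not> bval b s \<Longrightarrow> exec (While b c) s (1 + bcost b) s"
| WhileTrue: "bval b s \<Longrightarrow> exec c s t s' \<Longrightarrow> exec (While b c) s' u s'' \<Longrightarrow>
     exec (While b c) s (1 + bcost b + t + u) s''"


section \<open>The dynamic program\<close>

text \<open>
  Since \<open>wt\<close> has about \<open>n\<^sup>2\<close> entries, a linear-time algorithm has to receive it as the list of
  links: \<open>to[j]\<close> is the unique product that \<open>j\<close> can transit to, with \<open>to[j] = 0\<close> if there
  is none, and \<open>w[j]\<close> is the weight of that transition. All links are listed, including
  those that the algorithm removes. Nothing is assumed about other memory cells.
\<close>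

definition encodes :: "mcst \<Rightarrow> mem \<Rightarrow> bool" where
  "encodes I s \<longleftrightarrow>
     nmem s ''n'' 0 = nprod I \<and>
     (\<forall>j\<in>products I.
        rmem s ''r'' j = price I j \<and>
        rmem s ''lam'' j = arr I j \<and>
        rmem s ''v0'' j = wt I j 0 \<and>
        (let k = nmem s ''to'' j in
           if \<exists>i\<in>products I. 0 < wt I j i
           then k \<in> products I \<and> 0 < wt I j k \<and> rmem s ''w'' j = wt I j k
           else k = 0))"

abbreviation nvar :: "vname \<Rightarrow> nexp" where
  "nvar x \<equiv> NCell x (NConst 0)"

abbreviation rcell :: "vname \<Rightarrow> vname \<Rightarrow> rexp" where
  "rcell a x \<equiv> RCell a (nvar x)"

abbreviation nset :: "vname \<Rightarrow> nexp \<Rightarrow> com" where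
  "nset x e \<equiv> NAssign x (NConst 0) e"

text \<open>Does the link from \<open>j\<close> to \<open>k = to[j]\<close> exist, and does it survive the removal?\<close>

definition has_parent :: bexp where
  "has_parent = BAnd (NLess (NConst 0) (nvar ''k'')) (RLess (rcell ''r'' ''j'') (rcell ''r'' ''k''))"

text \<open>The second argument of the maximum, i.e. the value of not offering \<open>j\<close> below an offered \<open>k\<close>.\<close>

definition not_offered :: rexp where
  "not_offered =
     RAdd (RDiv (RMult (RMult (rcell ''lam'' ''j'') (rcell ''w'' ''j'')) (rcell ''r'' ''k''))
                (RAdd (rcell ''w'' ''j'') (rcell ''v0'' ''j'')))
          (rcell ''V0'' ''j'')"

definition init_tables :: com where
  "init_tables =
     nset ''j'' (nvar ''n'') ;;
     While (NLess (NConst 0) (nvar ''j''))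
       (RAssign ''V1'' (nvar ''j'') (RMult (rcell ''lam'' ''j'') (rcell ''r'' ''j'')) ;;
        RAssign ''V0'' (nvar ''j'') RZero ;;
        nset ''j'' (NPred (nvar ''j'')))"

text \<open>
  Parents have smaller indices than their children, so that going through the products in
  decreasing order goes from the leaves to the root. Each product, once its own entries are
  final, adds its term to the entries of its parent; a root adds its value to the total.
\<close>

definition fill_tables :: com where
  "fill_tables =
     RAssign ''opt'' (NConst 0) RZero ;;
     nset ''j'' (nvar ''n'') ;;
     While (NLess (NConst 0) (nvar ''j''))
       (nset ''k'' (NCell ''to'' (nvar ''j'')) ;;
        Cond has_parent
          (Cond (RLess (rcell ''V1'' ''j'') not_offered)
             (RAssign ''V1'' (nvar ''k'') (RAdd (rcell ''V1'' ''k'') not_offered))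
             (RAssign ''V1'' (nvar ''k'') (RAdd (rcell ''V1'' ''k'') (rcell ''V1'' ''j''))) ;;
           RAssign ''V0'' (nvar ''k'') (RAdd (rcell ''V0'' ''k'') (rcell ''V1'' ''j'')))
          (RAssign ''opt'' (NConst 0) (RAdd (RCell ''opt'' (NConst 0)) (rcell ''V1'' ''j''))) ;;
        nset ''j'' (NPred (nvar ''j'')))"

text \<open>
  From the root to the leaves, read off an optimal assortment: \<open>j\<close> is left out exactly
  if its parent is offered and the maximum for \<open>j\<close> is attained only by its second argument.
\<close>

definition trace_back :: com where
  "trace_back =
     nset ''j'' (NConst 1) ;;
     While (NLess (nvar ''j'') (NSucc (nvar ''n'')))
       (nset ''k'' (NCell ''to'' (nvar ''j'')) ;;
        Cond (BAnd (BAnd has_parent (NLess (NConst 0) (NCell ''sel'' (nvar ''k''))))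
                   (RLess (rcell ''V1'' ''j'') not_offered))
          (NAssign ''sel'' (nvar ''j'') (NConst 0))
          (NAssign ''sel'' (nvar ''j'') (NConst 1)) ;;
        nset ''j'' (NSucc (nvar ''j'')))"

definition mcst_dp :: com where
  "mcst_dp = init_tables ;; fill_tables ;; trace_back"

text \<open>
  The solution in memory: offer \<open>j\<close> iff \<open>sel[j] = 1\<close>, and recommend \<open>to[j]\<close> for \<open>j\<close> not offered.
\<close>

definition out_offered :: "mcst \<Rightarrow> mem \<Rightarrow> nat set" where
  "out_offered I s = {j \<in> products I. nmem s ''sel'' j = 1}"

definition out_recommended :: "mem \<Rightarrow> nat \<Rightarrow> nat set" where
  "out_recommended s j = {nmem s ''to'' j}"

end

theory Submission
  imports Defs
begin

text \<open>
  Once the offered set \<open>S\<close> is fixed, the recommendations decouple. A product \<open>j\<close> outside \<open>S\<close>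
  can transit to a single product \<open>k\<close>, so it can do no better than recommend \<open>k\<close> if \<open>k\<close> is
  offered. Hence the best revenue for \<open>S\<close> is a sum over the products of \<open>gain\<close>, which
  depends on \<open>S\<close> only through whether \<open>j\<close> and \<open>k\<close> are offered.

  The links from \<open>j\<close> to a product that is not more expensive are harmless to remove: over such
  a link \<open>j\<close> earns at most \<open>\<lambda>\<^sub>j r\<^sub>j\<close>, which offering \<open>j\<close> itself also earns, and enlarging the
  assortment never hurts another product that is left out. Thus a product without a remaining
  link, i.e. a root, may as well be offered (\<open>revenue_le_offering_roots\<close>). The remaining links
  strictly decrease the index and are unique for each product, so they form a forest.

  The subtree of \<open>i\<close> consists of \<open>i\<close> and the disjoint subtrees of its children, and the
  only interaction between \<open>i\<close> and the subtree of a child \<open>j\<close> is the amount \<open>transfer\<close> that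
  \<open>j\<close> passes on if \<open>i\<close> is offered and \<open>j\<close> is not (\<open>subtree_gain_local\<close>). So the optimum
  of the subtree is obtained by optimizing separately over each child, which is the recursion
  (\<open>subtree_opt_rec\<close>); when \<open>i\<close> is left out, offering \<open>j\<close> is the better choice because
  \<open>\<V>(j,0) \<le> \<V>(j,1)\<close>. In the same way the whole problem splits over the roots
  (\<open>mcst_opt_eq_sum_roots\<close>). An assortment that makes the maximizing choice at every product is
  optimal (\<open>traced_assortment_optimal\<close>), and this is how the assortment is read off.

  The program consists of three loops over the products with loop-free bodies, so its running
  time is linear. The invariant of the main loop says that the table entries for \<open>i\<close> are the
  right-hand sides of the recursion with the sums restricted to the children already processed;
  since children have larger indices, the entries of a product are final when it is reached.
\<close>

section \<open>Revenue of an assortment under best recommendations\<close>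

definition transfer :: "mcst \<Rightarrow> nat \<Rightarrow> nat \<Rightarrow> real" where
  "transfer I j k = arr I j * wt I j k * price I k / (wt I j k + wt I j 0)"

text \<open>
  A set with at most one element. Besides feeding \<open>inflow\<close>, the function
  \<open>parents_in I S\<close> is itself an optimal choice of recommendations for \<open>S\<close>.
\<close>

definition parents_in :: "mcst \<Rightarrow> nat set \<Rightarrow> nat \<Rightarrow> nat set" where
  "parents_in I S j = {k \<in> S. (j, k) \<in> links I}"

text \<open>
  Summing over the at most one parent in \<open>S\<close> gives 0 for roots and for products whose parent is
  not offered, without naming the parent.
\<close>

definition inflow :: "mcst \<Rightarrow> nat set \<Rightarrow> nat \<Rightarrow> real" where
  "inflow I S j = (\<Sum>k\<in>parents_in I S j. transfer I j k)"

text \<open>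
  The largest contribution of \<open>j\<close> to the revenue when \<open>S\<close> is offered and only the remaining
  links are used.
\<close>

definition gain :: "mcst \<Rightarrow> nat set \<Rightarrow> nat \<Rightarrow> real" where
  "gain I S j = (if j \<in> S then arr I j * price I j else inflow I S j)"

text \<open>
  Only the values of \<open>R\<close> on \<open>N - S\<close> enter the revenue, so \<open>R\<close> may be taken to be empty elsewhere.
  Finiteness lets the maxima in the definitions of the optima be attained.
\<close>

lemma finite_revenues:
  assumes "finite N"
  shows "finite {revenue I N w S R | S R. feasible N S R \<and> P S}"
proof -
  let ?F = "{f. \<forall>x. (x \<in> N \<longrightarrow> f x \<in> Pow N) \<and> (x \<notin> N \<longrightarrow> f x = {})}"
  have "finite ?F"
    using assms by (intro finite_set_of_finite_funs) auto
  then have "finite ((\<lambda>(S, R). revenue I N w S R) ` (Pow N \<times> ?F))"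
    using assms by auto
  moreover have "{revenue I N w S R | S R. feasible N S R \<and> P S}
      \<subseteq> (\<lambda>(S, R). revenue I N w S R) ` (Pow N \<times> ?F)"
  proof clarify
    fix S R assume *: "feasible N S R" "P S"
    let ?R = "\<lambda>j. if j \<in> N - S then R j else {}"
    have "revenue I N w S R = revenue I N w S ?R"
      unfolding revenue_def by (intro arg_cong2[where f = "(+)"] sum.cong) auto
    moreover have "(S, ?R) \<in> Pow N \<times> ?F"
      using * unfolding feasible_def by auto
    ultimately show "revenue I N w S R \<in> (\<lambda>(S, R). revenue I N w S R) ` (Pow N \<times> ?F)"
      by (metis (no_types, lifting) image_eqI case_prod_conv)
  qed
  ultimately show ?thesis by (rule finite_subset[rotated])
qed

locale single_link_instance =
  fixes I :: mcst
  assumes valid: "valid_mcst I" and single: "single_link I"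
begin

lemma finite_products [simp]: "finite (products I)"
  by (simp add: products_def)

lemma
  shows price_nonneg: "j \<in> products I \<Longrightarrow> 0 \<le> price I j"
    and arr_nonneg: "j \<in> products I \<Longrightarrow> 0 \<le> arr I j"
    and wt_nonneg: "j \<in> products I \<Longrightarrow> i \<in> products I \<Longrightarrow> 0 \<le> wt I j i"
    and wt_0_nonneg: "j \<in> products I \<Longrightarrow> 0 \<le> wt I j 0"
  using valid unfolding valid_mcst_def by auto

lemma zero_not_product: "0 \<notin> products I"
  by (simp add: products_def)

lemma link_products: "(j, k) \<in> links I \<Longrightarrow> j \<in> products I \<and> k \<in> products I"
  by (simp add: links_def)

lemma finite_children [simp]: "finite (children I i)"
  by (rule finite_subset[OF _ finite_products]) (auto simp: children_def dest: link_products)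

lemma finite_roots [simp]: "finite (roots I)"
  by (simp add: roots_def)

lemma finite_subtree [simp]: "finite (subtree I i)"
  by (simp add: subtree_def)

lemma subtree_subset: "subtree I i \<subseteq> products I"
  by (auto simp: subtree_def)

lemma self_in_subtree: "i \<in> products I \<Longrightarrow> i \<in> subtree I i"
  by (simp add: subtree_def)

lemma link_decreasing:
  assumes "(j, k) \<in> links I"
  shows "k < j"
proof (rule ccontr)
  assume "\<not> k < j"
  with assms valid have "price I k \<le> price I j"
    unfolding valid_mcst_def links_def by auto
  with assms show False by (simp add: links_def)
qed

lemma reach_le: "(j, k) \<in> (links I)\<^sup>* \<Longrightarrow> k \<le> j"
  by (induction rule: rtrancl_induct) (auto dest: link_decreasing)

lemma transition_unique:
  assumes "j \<in> products I" "i \<in> products I" "k \<in> products I" "0 < wt I j i" "0 < wt I j k"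
  shows "i = k"
proof -
  have "card {i \<in> products I. 0 < wt I j i} \<le> 1"
    using single assms(1) by (simp add: single_link_def)
  then show ?thesis
    using assms by (auto simp: card_le_Suc0_iff_eq)
qed

lemma link_unique: "(j, i) \<in> links I \<Longrightarrow> (j, k) \<in> links I \<Longrightarrow> i = k"
  by (auto simp: links_def intro: transition_unique)

lemma single_valued_links: "single_valued (links I)"
  by (auto simp: single_valued_def intro: link_unique)

lemma parents_in_eq:
  assumes "(j, k) \<in> links I"
  shows "parents_in I S j = (if k \<in> S then {k} else {})"
  using assms link_unique by (auto simp: parents_in_def)

lemma inflow_eq:
  assumes "(j, k) \<in> links I"
  shows "inflow I S j = (if k \<in> S then transfer I j k else 0)"
  by (simp add: inflow_def parents_in_eq[OF assms])

lemma inflow_no_parent: "(\<And>k. k \<in> S \<Longrightarrow> (j, k) \<notin> links I) \<Longrightarrow> inflow I S j = 0"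
  by (auto simp: inflow_def parents_in_def intro: sum.neutral)

lemma transfer_nonneg: "(j, k) \<in> links I \<Longrightarrow> 0 \<le> transfer I j k"
  using link_products[of j k]
  by (auto simp: transfer_def intro!: divide_nonneg_nonneg mult_nonneg_nonneg add_nonneg_nonneg
      arr_nonneg wt_nonneg wt_0_nonneg price_nonneg)

lemma inflow_nonneg: "0 \<le> inflow I S j"
  by (auto simp: inflow_def parents_in_def intro!: sum_nonneg transfer_nonneg)

lemma inflow_mono: "S \<subseteq> S' \<Longrightarrow> inflow I S j \<le> inflow I S' j"
  by (cases "\<exists>k. (j, k) \<in> links I")
    (auto simp: inflow_eq inflow_no_parent transfer_nonneg)

text \<open>
  Offering more products can lower the gain only of a newly offered product.
\<close>

lemma gain_mono: "S \<subseteq> S' \<Longrightarrow> (j \<in> S' \<Longrightarrow> j \<in> S) \<Longrightarrow> gain I S j \<le> gain I S' j"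
  by (auto simp: gain_def inflow_mono)

text \<open>
  If every product of positive weight in \<open>R\<close> is a parent of \<open>j\<close>, the two sums collapse to the single
  term of the parent, or to 0. The weights are arbitrary so that both the pruned weights and the
  original ones of a product with a parent are covered.
\<close>

lemma ratio_le_inflow:
  assumes R: "R \<subseteq> S" and w: "\<And>i. i \<in> R \<Longrightarrow> w i \<noteq> 0 \<Longrightarrow> (j, i) \<in> links I \<and> w i = wt I j i"
    and w0: "w0 = wt I j 0"
  shows "arr I j * ((\<Sum>i\<in>R. price I i * w i) / ((\<Sum>i\<in>R. w i) + w0)) \<le> inflow I S j"
proof (cases "\<exists>k\<in>R. w k \<noteq> 0 \<and> finite R")
  case True
  then obtain k where k: "k \<in> R" "w k \<noteq> 0" "finite R" by blast
  then have link: "(j, k) \<in> links I" and wk: "w k = wt I j k" using w by auto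
  have "w i = 0" if "i \<in> R - {k}" for i
    using that w link link_unique by blast
  then have "(\<Sum>i\<in>R. price I i * w i) = price I k * w k" "(\<Sum>i\<in>R. w i) = w k"
    using k by (simp_all add: sum.remove[of R k])
  then show ?thesis
    using R k by (auto simp: inflow_eq[OF link] transfer_def wk w0 mult_ac)
next
  case False
  then have "(\<Sum>i\<in>R. price I i * w i) = 0"
    by (cases "finite R") auto
  then show ?thesis by (simp add: inflow_nonneg)
qed

lemma sum_gain_split:
  assumes "finite N" "S \<subseteq> N"
  shows "(\<Sum>j\<in>N. gain I S j) = (\<Sum>i\<in>S. arr I i * price I i) + (\<Sum>j\<in>N - S. inflow I S j)"
proof -
  have "(\<Sum>j\<in>N. gain I S j) = (\<Sum>j\<in>S. gain I S j) + (\<Sum>j\<in>N - S. gain I S j)"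
    using sum.subset_diff[OF assms(2,1)] by (simp add: add.commute)
  then show ?thesis by (simp add: gain_def)
qed

lemma revenue_recommend_parent:
  assumes N: "N \<subseteq> products I" and S: "S \<subseteq> N"
    and w: "\<And>j k. (j, k) \<in> links I \<Longrightarrow> w j k = wt I j k" and w0: "\<And>j. w j 0 = wt I j 0"
  shows "revenue I N w S (parents_in I S) = (\<Sum>j\<in>N. gain I S j)"
proof -
  have "arr I j * ((\<Sum>i\<in>parents_in I S j. price I i * w j i) /
      ((\<Sum>i\<in>parents_in I S j. w j i) + w j 0)) = inflow I S j" for j
  proof (cases "\<exists>k. (j, k) \<in> links I")
    case True
    then obtain k where k: "(j, k) \<in> links I" by blast
    show ?thesis
      by (simp add: parents_in_eq[OF k] inflow_eq[OF k] transfer_def w[OF k] w0 mult_ac)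
  next
    case False
    then show ?thesis by (simp add: parents_in_def inflow_def)
  qed
  then show ?thesis
    unfolding revenue_def using sum_gain_split[OF finite_subset[OF N finite_products] S] by simp
qed

lemma revenue_pruned_le:
  assumes N: "N \<subseteq> products I" and "feasible N S R"
  shows "revenue I N (pruned I) S R \<le> (\<Sum>j\<in>N. gain I S j)"
proof -
  have S: "S \<subseteq> N" and R: "\<And>j. j \<in> N - S \<Longrightarrow> R j \<subseteq> S"
    using assms(2) by (auto simp: feasible_def)
  have "arr I j * ((\<Sum>i\<in>R j. price I i * pruned I j i) / ((\<Sum>i\<in>R j. pruned I j i) + pruned I j 0))
      \<le> inflow I S j" if "j \<in> N - S" for j
  proof (rule ratio_le_inflow[OF R[OF that]])
    fix i assume "i \<in> R j" "pruned I j i \<noteq> 0"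
    moreover have "i \<noteq> 0"
      using subsetD[OF R[OF that] \<open>i \<in> R j\<close>] S N zero_not_product by (metis subsetD)
    ultimately show "(j, i) \<in> links I \<and> pruned I j i = wt I j i"
      by (auto simp: pruned_def split: if_splits)
  qed (simp add: pruned_def)
  then have "(\<Sum>j\<in>N - S. arr I j * ((\<Sum>i\<in>R j. price I i * pruned I j i) /
      ((\<Sum>i\<in>R j. pruned I j i) + pruned I j 0))) \<le> (\<Sum>j\<in>N - S. inflow I S j)"
    by (rule sum_mono)
  then show ?thesis
    using sum_gain_split[OF finite_subset[OF N finite_products] S] by (simp add: revenue_def)
qed

text \<open>
  The ratio is an average of prices, weighted by transition probabilities, with the no-purchase
  option counted at price 0.
\<close>

lemma ratio_le_own_price:
  assumes j: "j \<in> products I" and R: "R \<subseteq> products I"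
    and up: "\<And>i. i \<in> R \<Longrightarrow> 0 < wt I j i \<Longrightarrow> price I i \<le> price I j"
  shows "(\<Sum>i\<in>R. price I i * wt I j i) / ((\<Sum>i\<in>R. wt I j i) + wt I j 0) \<le> price I j"
proof -
  have w: "0 \<le> wt I j i" if "i \<in> R" for i
    using that R j by (auto intro: wt_nonneg)
  have "price I i * wt I j i \<le> price I j * wt I j i" if "i \<in> R" for i
    using that up[OF that] w[OF that] by (cases "wt I j i = 0") (auto intro: mult_right_mono)
  then have "(\<Sum>i\<in>R. price I i * wt I j i) \<le> price I j * (\<Sum>i\<in>R. wt I j i)"
    unfolding sum_distrib_left by (rule sum_mono)
  also have "\<dots> \<le> price I j * ((\<Sum>i\<in>R. wt I j i) + wt I j 0)"
    using price_nonneg[OF j] wt_0_nonneg[OF j] by (intro mult_left_mono) auto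
  finally have *: "(\<Sum>i\<in>R. price I i * wt I j i) \<le> price I j * ((\<Sum>i\<in>R. wt I j i) + wt I j 0)" .
  have "0 \<le> (\<Sum>i\<in>R. wt I j i) + wt I j 0"
    using w wt_0_nonneg[OF j] by (intro add_nonneg_nonneg sum_nonneg)
  then show ?thesis
    using * price_nonneg[OF j] by (cases "(\<Sum>i\<in>R. wt I j i) + wt I j 0 = 0") (auto simp: divide_le_eq)
qed

text \<open>
  The removed links are dispensable: a product outside \<open>S\<close> without a parent can reach only
  products that are no more expensive than itself, so offering it earns at least as much.
\<close>

lemma revenue_le_offering_roots:
  assumes "feasible (products I) S R"
  shows "revenue I (products I) (wt I) S R \<le> (\<Sum>j\<in>products I. gain I (S \<union> roots I) j)"
proof -
  let ?S = "S \<union> roots I"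
  let ?term = "\<lambda>j. arr I j * ((\<Sum>i\<in>R j. price I i * wt I j i) / ((\<Sum>i\<in>R j. wt I j i) + wt I j 0))"
  have S: "S \<subseteq> products I" and R: "\<And>j. j \<in> products I - S \<Longrightarrow> R j \<subseteq> S"
    using assms by (auto simp: feasible_def)
  have "?term j \<le> gain I ?S j" if j: "j \<in> products I - S" for j
  proof (cases "j \<in> roots I")
    case True
    have "(\<Sum>i\<in>R j. price I i * wt I j i) / ((\<Sum>i\<in>R j. wt I j i) + wt I j 0) \<le> price I j"
    proof (rule ratio_le_own_price)
      show "price I i \<le> price I j" if i: "i \<in> R j" "0 < wt I j i" for i
      proof -
        have "(j, i) \<notin> links I" "i \<in> products I"
          using True i R[OF j] S by (auto simp: roots_def)
        then show ?thesis using i j by (auto simp: links_def)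
      qed
    qed (use j R[OF j] S in auto)
    then show ?thesis
      unfolding gain_def using True j arr_nonneg[of j]
      by (simp only: Un_iff simp_thms if_True) (intro mult_left_mono, auto)
  next
    case False
    then obtain k where k: "(j, k) \<in> links I" using j by (auto simp: roots_def)
    have "?term j \<le> inflow I S j"
    proof (rule ratio_le_inflow[OF R[OF j]])
      fix i assume i: "i \<in> R j" "wt I j i \<noteq> 0"
      then have ip: "i \<in> products I" using R[OF j] S by blast
      then have "0 < wt I j i" using wt_nonneg[of j i] i j by auto
      then have "i = k"
        using k ip by (intro transition_unique[of j i k]) (auto simp: links_def)
      then show "(j, i) \<in> links I \<and> wt I j i = wt I j i" using k by simp
    qed simp
    also have "\<dots> \<le> inflow I ?S j" by (rule inflow_mono) simp
    finally show ?thesis using False j by (simp add: gain_def)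
  qed
  then have "revenue I (products I) (wt I) S R \<le>
      (\<Sum>i\<in>S. gain I ?S i) + (\<Sum>j\<in>products I - S. gain I ?S j)"
    unfolding revenue_def by (intro add_mono sum_mono) (auto simp: gain_def)
  also have "\<dots> = (\<Sum>j\<in>products I. gain I ?S j)"
    using sum.subset_diff[OF S finite_products, of "gain I ?S"] by simp
  finally show ?thesis .
qed

lemma feasible_parents_in: "S \<subseteq> N \<Longrightarrow> feasible N S (parents_in I S)"
  by (auto simp: feasible_def parents_in_def)

section \<open>Subtree optima as maxima of gains\<close>

text \<open>
  Together with the attainment lemma below, this replaces the maximum over pairs \<open>(S, R)\<close> by a
  maximum of a sum of local terms over \<open>S\<close> alone.
\<close>

lemma gain_le_subtree_opt:
  assumes "S \<subseteq> subtree I i"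
  shows "(\<Sum>j\<in>subtree I i. gain I S j) \<le> subtree_opt I i (i \<in> S)"
proof -
  have "revenue I (subtree I i) (pruned I) S (parents_in I S) = (\<Sum>j\<in>subtree I i. gain I S j)"
    using assms by (intro revenue_recommend_parent subtree_subset) (auto simp: pruned_def)
  then show ?thesis
    unfolding subtree_opt_def
    using feasible_parents_in[OF assms] by (intro Max_ge finite_revenues) force+
qed

lemma subtree_opt_attained:
  assumes "i \<in> products I"
  obtains S where "S \<subseteq> subtree I i" "i \<in> S \<longleftrightarrow> b"
    "(\<Sum>j\<in>subtree I i. gain I S j) = subtree_opt I i b"
proof -
  let ?V = "{revenue I (subtree I i) (pruned I) S R | S R.
               feasible (subtree I i) S R \<and> (i \<in> S \<longleftrightarrow> b)}"
  have "feasible (subtree I i) (if b then {i} else {}) (\<lambda>_. {})"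
    using self_in_subtree[OF assms] by (auto simp: feasible_def)
  then have "?V \<noteq> {}" by (cases b) force+
  then have "subtree_opt I i b \<in> ?V"
    unfolding subtree_opt_def by (intro Max_in finite_revenues) simp_all
  then obtain S R where SR: "feasible (subtree I i) S R" "i \<in> S \<longleftrightarrow> b"
    "subtree_opt I i b = revenue I (subtree I i) (pruned I) S R"
    by blast
  have S: "S \<subseteq> subtree I i" using SR(1) by (simp add: feasible_def)
  show thesis
    using that[OF S SR(2)] revenue_pruned_le[OF subtree_subset SR(1)] gain_le_subtree_opt[OF S] SR
    by force
qed

section \<open>The optimal value of the whole problem as a maximum of gains\<close>

lemma gain_le_mcst_opt:
  assumes "S \<subseteq> products I"
  shows "(\<Sum>j\<in>products I. gain I S j) \<le> mcst_opt I"
proof -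
  have "revenue I (products I) (wt I) S (parents_in I S) = (\<Sum>j\<in>products I. gain I S j)"
    using assms by (intro revenue_recommend_parent) auto
  moreover have "finite {revenue I (products I) (wt I) S R | S R. feasible (products I) S R}"
    using finite_revenues[of "products I" I "wt I" "\<lambda>_. True"] by simp
  ultimately show ?thesis
    unfolding mcst_opt_def using feasible_parents_in[OF assms] by (intro Max_ge) force+
qed

text \<open>
  The optimal value uses the original weights but is attained by an assortment valued
  over the remaining links only, after adding the roots to a given optimal assortment.
\<close>

lemma mcst_opt_attained:
  obtains S where "S \<subseteq> products I" "(\<Sum>j\<in>products I. gain I S j) = mcst_opt I"
proof -
  let ?V = "{revenue I (products I) (wt I) S R | S R. feasible (products I) S R}"
  have "finite ?V"
    using finite_revenues[of "products I" I "wt I" "\<lambda>_. True"] by simp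
  moreover have "feasible (products I) {} (\<lambda>_. {})" by (simp add: feasible_def)
  then have "?V \<noteq> {}" by blast
  ultimately have "mcst_opt I \<in> ?V" unfolding mcst_opt_def by (rule Max_in)
  then obtain S R where SR: "feasible (products I) S R"
    "mcst_opt I = revenue I (products I) (wt I) S R" by blast
  have S: "S \<union> roots I \<subseteq> products I" using SR(1) by (auto simp: feasible_def roots_def)
  show thesis
    using that[OF S] revenue_le_offering_roots[OF SR(1)] gain_le_mcst_opt[OF S] SR by force
qed

section \<open>The decomposition into subtrees\<close>

text \<open>
  Each product has at most one parent, so two products reachable from a common one are
  reachable one from the other.
\<close>

lemma subtrees_disjoint:
  assumes "(i, j) \<notin> (links I)\<^sup>*" "(j, i) \<notin> (links I)\<^sup>*"
  shows "subtree I i \<inter> subtree I j = {}"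
  using assms single_valued_confluent[OF single_valued_links]
  by (auto simp: subtree_def)

lemma disjoint_child_subtrees:
  assumes "j \<in> children I i" "j' \<in> children I i" "j \<noteq> j'"
  shows "subtree I j \<inter> subtree I j' = {}"
proof -
  have no: "(a, b) \<notin> (links I)\<^sup>*"
    if "a \<in> children I i" "b \<in> children I i" "a \<noteq> b" for a b
  proof
    assume "(a, b) \<in> (links I)\<^sup>*"
    then obtain k where "(a, k) \<in> links I" "(k, b) \<in> (links I)\<^sup>*"
      using \<open>a \<noteq> b\<close> by (auto elim: converse_rtranclE)
    then have "b \<le> i"
      using that(1) link_unique[of a i k] reach_le[of k b] by (auto simp: children_def)
    moreover have "i < b" using that(2) link_decreasing by (auto simp: children_def)
    ultimately show False by simp
  qed
  show ?thesis using assms by (intro subtrees_disjoint no) auto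
qed

lemma root_reaches: "j \<in> roots I \<Longrightarrow> (j, k) \<in> (links I)\<^sup>* \<Longrightarrow> k = j"
  by (auto simp: roots_def elim: converse_rtranclE)

lemma disjoint_root_subtrees:
  assumes "j \<in> roots I" "j' \<in> roots I" "j \<noteq> j'"
  shows "subtree I j \<inter> subtree I j' = {}"
  using assms root_reaches by (intro subtrees_disjoint) auto

lemma subtree_eq:
  assumes "i \<in> products I"
  shows "subtree I i = insert i (\<Union>j\<in>children I i. subtree I j)"
  using assms
  by (auto simp: subtree_def children_def elim: rtranclE intro: rtrancl_into_rtrancl)

lemma not_in_child_subtree:
  assumes "j \<in> children I i"
  shows "i \<notin> subtree I j"
  using assms link_decreasing reach_le by (fastforce simp: children_def subtree_def)

lemma products_eq_Union_roots: "products I = (\<Union>j\<in>roots I. subtree I j)"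
proof -
  have "\<exists>i\<in>roots I. (j, i) \<in> (links I)\<^sup>*" if "j \<in> products I" for j
    using that
  proof (induction j rule: less_induct)
    case (less j)
    show ?case
    proof (cases "j \<in> roots I")
      case False
      then obtain k where "(j, k) \<in> links I" using less.prems by (auto simp: roots_def)
      then show ?thesis
        using less.IH[of k] link_decreasing link_products
        by (meson converse_rtrancl_into_rtrancl)
    qed auto
  qed
  then show ?thesis by (auto simp: subtree_def)
qed

lemma sum_subtree:
  assumes "i \<in> products I"
  shows "(\<Sum>x\<in>subtree I i. f x) = f i + (\<Sum>j\<in>children I i. \<Sum>x\<in>subtree I j. f x)"
proof -
  have "(\<Sum>x\<in>subtree I i. f x) = f i + (\<Sum>x\<in>(\<Union>j\<in>children I i. subtree I j). f x)"
    unfolding subtree_eq[OF assms] using not_in_child_subtree by (subst sum.insert) auto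
  also have "(\<Sum>x\<in>(\<Union>j\<in>children I i. subtree I j). f x) = (\<Sum>j\<in>children I i. \<Sum>x\<in>subtree I j. f x)"
    using disjoint_child_subtrees by (intro sum.UNION_disjoint) auto
  finally show ?thesis .
qed

lemma sum_products: "(\<Sum>x\<in>products I. f x) = (\<Sum>j\<in>roots I. \<Sum>x\<in>subtree I j. f x)"
  unfolding products_eq_Union_roots
  using disjoint_root_subtrees by (intro sum.UNION_disjoint) auto

lemma no_inflow_within_subtree:
  assumes "S \<subseteq> subtree I i"
  shows "inflow I S i = 0"
proof (rule inflow_no_parent)
  fix k assume "k \<in> S"
  then have "i \<le> k" using assms reach_le by (auto simp: subtree_def)
  then show "(i, k) \<notin> links I" using link_decreasing by fastforce
qed

text \<open>
  The link that leaves the subtree of \<open>i\<close> starts at \<open>i\<close>, so products outside the subtree influence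
  the gains inside it only through the inflow of \<open>i\<close>.
\<close>

lemma subtree_gain_local:
  assumes "i \<in> products I"
  shows "(\<Sum>j\<in>subtree I i. gain I S j) =
    (\<Sum>j\<in>subtree I i. gain I (S \<inter> subtree I i) j) + (if i \<in> S then 0 else inflow I S i)"
proof -
  have i: "i \<in> subtree I i" by (rule self_in_subtree[OF assms])
  have rest: "gain I S j = gain I (S \<inter> subtree I i) j" if "j \<in> subtree I i - {i}" for j
  proof -
    have "(j, i) \<in> (links I)\<^sup>*" "j \<noteq> i" using that by (auto simp: subtree_def)
    then obtain k where k: "(j, k) \<in> links I" "(k, i) \<in> (links I)\<^sup>*"
      by (auto elim: converse_rtranclE)
    then have "k \<in> subtree I i" using link_products by (auto simp: subtree_def)
    then show ?thesis using that by (auto simp: gain_def inflow_eq[OF k(1)])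
  qed
  have "inflow I (S \<inter> subtree I i) i = 0" by (simp add: no_inflow_within_subtree)
  then have "gain I S i = gain I (S \<inter> subtree I i) i + (if i \<in> S then 0 else inflow I S i)"
    using i by (simp add: gain_def)
  then show ?thesis
    using rest by (simp add: sum.remove[OF finite_subtree i])
qed

text \<open>
  Optimal assortments of disjoint subtrees combine: cutting the union back to one of the
  subtrees recovers the assortment chosen there.
\<close>

lemma splice_optima:
  assumes C: "finite C" "C \<subseteq> products I"
    and disj: "\<And>i j. i \<in> C \<Longrightarrow> j \<in> C \<Longrightarrow> i \<noteq> j \<Longrightarrow> subtree I i \<inter> subtree I j = {}"
  obtains T where "T \<subseteq> (\<Union>j\<in>C. subtree I j)" "\<And>j. j \<in> C \<Longrightarrow> j \<in> T \<longleftrightarrow> b j"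
    "\<And>j. j \<in> C \<Longrightarrow> (\<Sum>x\<in>subtree I j. gain I (T \<inter> subtree I j) x) = subtree_opt I j (b j)"
proof -
  have "\<forall>j\<in>C. \<exists>S. S \<subseteq> subtree I j \<and> (j \<in> S \<longleftrightarrow> b j) \<and>
      (\<Sum>x\<in>subtree I j. gain I S x) = subtree_opt I j (b j)"
    using C(2) subtree_opt_attained by (metis subsetD)
  then obtain S where S: "\<And>j. j \<in> C \<Longrightarrow> S j \<subseteq> subtree I j" "\<And>j. j \<in> C \<Longrightarrow> j \<in> S j \<longleftrightarrow> b j"
    "\<And>j. j \<in> C \<Longrightarrow> (\<Sum>x\<in>subtree I j. gain I (S j) x) = subtree_opt I j (b j)"
    by metis
  define T where "T = (\<Union>j\<in>C. S j)"
  have cut: "T \<inter> subtree I j = S j" if "j \<in> C" for j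
    using that S(1) disj unfolding T_def by blast
  show thesis
  proof (rule that)
    show "T \<subseteq> (\<Union>j\<in>C. subtree I j)" using S(1) by (auto simp: T_def)
    show "j \<in> T \<longleftrightarrow> b j" if "j \<in> C" for j
      using cut[OF that] S(2)[OF that] self_in_subtree[of j] that C(2) by blast
  qed (simp add: cut S(3))
qed

text \<open>
  Adding \<open>i\<close> to an assortment of its own subtree only adds revenue, since \<open>i\<close> left out earns
  nothing there: its parent is outside.
\<close>

lemma subtree_opt_False_le_True:
  assumes "i \<in> products I"
  shows "subtree_opt I i False \<le> subtree_opt I i True"
proof -
  obtain S where S: "S \<subseteq> subtree I i" "i \<notin> S"
    "(\<Sum>j\<in>subtree I i. gain I S j) = subtree_opt I i False"
    using subtree_opt_attained[OF assms, of False] by auto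
  have i: "i \<in> subtree I i" by (rule self_in_subtree[OF assms])
  have "gain I S j \<le> gain I (insert i S) j" if "j \<in> subtree I i" for j
  proof (cases "j = i")
    case True
    have "inflow I S i = 0" using S(1) by (rule no_inflow_within_subtree)
    then show ?thesis
      using True S(2) arr_nonneg[OF assms] price_nonneg[OF assms] by (simp add: gain_def)
  next
    case False
    then show ?thesis by (intro gain_mono) auto
  qed
  then have "(\<Sum>j\<in>subtree I i. gain I S j) \<le> (\<Sum>j\<in>subtree I i. gain I (insert i S) j)"
    by (rule sum_mono)
  also have "\<dots> \<le> subtree_opt I i True"
    using gain_le_subtree_opt[of "insert i S" i] S(1) i by simp
  finally show ?thesis using S(3) by simp
qed

section \<open>The recursion\<close>

text \<open>
  The term that a child \<open>j\<close> contributes to \<open>\<V>(i,1)\<close> (for \<open>b\<close> true) or to \<open>\<V>(i,0)\<close>; one function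
  for both lets the recursion be proved for both cases at once.
\<close>

definition child_value :: "bool \<Rightarrow> nat \<Rightarrow> nat \<Rightarrow> real" where
  "child_value b i j = (if b then max (subtree_opt I j True) (transfer I j i + subtree_opt I j False)
                        else subtree_opt I j True)"

text \<open>
  Both inequalities compare the two sides child by child. An optimal assortment cut down to
  the subtree of a child is a candidate there; conversely, optimal assortments of the children,
  where each child is offered or not according to the maximum, can be spliced together. Leaves
  need no separate treatment, as their sum is empty.
\<close>

lemma subtree_opt_rec:
  assumes i: "i \<in> products I"
  shows "subtree_opt I i b =
    (if b then arr I i * price I i else 0) + (\<Sum>j\<in>children I i. child_value b i j)"
proof -
  have child: "j \<in> products I" "(j, i) \<in> links I" if "j \<in> children I i" for j
    using that link_products by (auto simp: children_def)
  \<comment> \<open>The gain in the subtree, split into terms that each depend on one child's part of \<open>S\<close> only.\<close>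
  have expand: "(\<Sum>x\<in>subtree I i. gain I S x) =
      (if i \<in> S then arr I i * price I i else 0) +
      (\<Sum>j\<in>children I i. (\<Sum>x\<in>subtree I j. gain I (S \<inter> subtree I j) x) +
         (if j \<notin> S \<and> i \<in> S then transfer I j i else 0))" if "S \<subseteq> subtree I i" for S
  proof -
    have "inflow I S i = 0" using that by (rule no_inflow_within_subtree)
    then show ?thesis
      unfolding sum_subtree[OF i]
      by (auto simp: gain_def[of I S i] subtree_gain_local[OF child(1), of _ S]
          inflow_eq[OF child(2)] intro!: sum.cong)
  qed
  show ?thesis
  proof (rule antisym)
    obtain S where S: "S \<subseteq> subtree I i" "i \<in> S \<longleftrightarrow> b"
      "(\<Sum>j\<in>subtree I i. gain I S j) = subtree_opt I i b"
      using subtree_opt_attained[OF i] .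
    have "(\<Sum>x\<in>subtree I j. gain I (S \<inter> subtree I j) x) +
        (if j \<notin> S \<and> i \<in> S then transfer I j i else 0) \<le> child_value b i j"
      if j: "j \<in> children I i" for j
    proof -
      have "(\<Sum>x\<in>subtree I j. gain I (S \<inter> subtree I j) x) \<le> subtree_opt I j (j \<in> S)"
        using gain_le_subtree_opt[of "S \<inter> subtree I j" j] self_in_subtree[OF child(1)[OF j]] by simp
      then show ?thesis
        using S(2) subtree_opt_False_le_True[OF child(1)[OF j]] by (auto simp: child_value_def)
    qed
    then show "subtree_opt I i b \<le>
        (if b then arr I i * price I i else 0) + (\<Sum>j\<in>children I i. child_value b i j)"
      unfolding S(3)[symmetric] expand[OF S(1)] S(2) by (intro add_mono sum_mono) auto
  next
    \<comment> \<open>A tie is broken in favour of offering, as in the tracing rule.\<close>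
    define offer where "offer j \<longleftrightarrow>
      \<not> (b \<and> subtree_opt I j True < transfer I j i + subtree_opt I j False)" for j
    obtain T where T: "T \<subseteq> (\<Union>j\<in>children I i. subtree I j)"
      "\<And>j. j \<in> children I i \<Longrightarrow> j \<in> T \<longleftrightarrow> offer j"
      "\<And>j. j \<in> children I i \<Longrightarrow>
        (\<Sum>x\<in>subtree I j. gain I (T \<inter> subtree I j) x) = subtree_opt I j (offer j)"
      using splice_optima[of "children I i" offer] child(1) disjoint_child_subtrees
      by (metis finite_children subsetI)
    define S where "S = T \<union> (if b then {i} else {})"
    have "i \<notin> T" using T(1) not_in_child_subtree by blast
    then have iS: "i \<in> S \<longleftrightarrow> b" by (simp add: S_def)
    have S: "S \<subseteq> subtree I i" using T(1) by (auto simp: S_def subtree_eq[OF i])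
    have cut: "S \<inter> subtree I j = T \<inter> subtree I j" "j \<in> S \<longleftrightarrow> offer j"
      if "j \<in> children I i" for j
      using that not_in_child_subtree[OF that] T(2)[OF that] child(2)[OF that] link_decreasing
      by (auto simp: S_def)
    have "(\<Sum>j\<in>children I i. child_value b i j) = (\<Sum>j\<in>children I i.
        (\<Sum>x\<in>subtree I j. gain I (S \<inter> subtree I j) x) +
         (if j \<notin> S \<and> i \<in> S then transfer I j i else 0))"
      by (rule sum.cong) (auto simp: cut T(3) iS child_value_def offer_def)
    then show "(if b then arr I i * price I i else 0) + (\<Sum>j\<in>children I i. child_value b i j)
        \<le> subtree_opt I i b"
      using gain_le_subtree_opt[OF S] unfolding expand[OF S] iS by simp
  qed
qed

lemma sum_gain_roots: 
  "(\<Sum>x\<in>products I. gain I S x) = (\<Sum>j\<in>roots I. \<Sum>x\<in>subtree I j. gain I (S \<inter> subtree I j) x)"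
  unfolding sum_products
  by (rule sum.cong) (auto simp: subtree_gain_local[of _ S] inflow_no_parent roots_def)

text \<open>
  Offering all roots is optimal, and the subtrees of the roots do not interact.
\<close>

lemma mcst_opt_eq_sum_roots: "mcst_opt I = (\<Sum>i\<in>roots I. subtree_opt I i True)"
proof (rule antisym)
  have rootp: "i \<in> products I" if "i \<in> roots I" for i using that by (simp add: roots_def)
  obtain S where S: "S \<subseteq> products I" "(\<Sum>j\<in>products I. gain I S j) = mcst_opt I"
    using mcst_opt_attained .
  have "(\<Sum>x\<in>subtree I i. gain I (S \<inter> subtree I i) x) \<le> subtree_opt I i True"
    if "i \<in> roots I" for i
    using gain_le_subtree_opt[of "S \<inter> subtree I i" i] subtree_opt_False_le_True[OF rootp[OF that]]
    by (cases "i \<in> S \<inter> subtree I i") auto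
  then show "mcst_opt I \<le> (\<Sum>i\<in>roots I. subtree_opt I i True)"
    unfolding S(2)[symmetric] sum_gain_roots by (rule sum_mono)
  obtain T where T: "T \<subseteq> (\<Union>j\<in>roots I. subtree I j)"
    "\<And>j. j \<in> roots I \<Longrightarrow>
        (\<Sum>x\<in>subtree I j. gain I (T \<inter> subtree I j) x) = subtree_opt I j True"
    using splice_optima[of "roots I" "\<lambda>_. True"] rootp disjoint_root_subtrees
    by (metis finite_roots subsetI)
  have "(\<Sum>i\<in>roots I. subtree_opt I i True) = (\<Sum>x\<in>products I. gain I T x)"
    unfolding sum_gain_roots by (simp add: T(2))
  also have "\<dots> \<le> mcst_opt I"
    using T(1) products_eq_Union_roots by (intro gain_le_mcst_opt) simp
  finally show "(\<Sum>i\<in>roots I. subtree_opt I i True) \<le> mcst_opt I" .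
qed

lemma roots_of_tree:
  assumes "\<forall>i\<in>products I. (i, 1) \<in> (links I)\<^sup>*"
  shows "roots I = {1}"
proof -
  have "products I \<noteq> {}" using valid by (auto simp: valid_mcst_def)
  then have one: "1 \<in> products I" by (auto simp: products_def)
  have "(1, k) \<notin> links I" for k
    using link_decreasing[of 1 k] link_products[of 1 k] zero_not_product by auto
  then have "1 \<in> roots I" using one by (simp add: roots_def)
  moreover have "i = 1" if "i \<in> roots I" for i
    using that assms root_reaches[of i 1] by (auto simp: roots_def)
  ultimately show ?thesis by blast
qed

text \<open>
  By induction from the leaves to the root, the gain of \<open>S\<close> in the subtree of \<open>i\<close> is the optimum for
  the given choice at \<open>i\<close>, plus what \<open>i\<close> passes to an offered parent.
\<close>

lemma traced_assortment_optimal: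
  assumes trace: "\<And>j. j \<in> products I \<Longrightarrow> j \<in> S \<longleftrightarrow>
      \<not> (\<exists>k\<in>S. (j, k) \<in> links I \<and> subtree_opt I j True < transfer I j k + subtree_opt I j False)"
  shows "(\<Sum>x\<in>products I. gain I S x) = mcst_opt I"
proof -
  have subtree_value: "(\<Sum>x\<in>subtree I i. gain I S x) =
      subtree_opt I i (i \<in> S) + (if i \<in> S then 0 else inflow I S i)" if "i \<in> products I" for i
    using that
  proof (induction "nprod I - i" arbitrary: i rule: less_induct)
    case less
    have "(\<Sum>x\<in>subtree I j. gain I S x) = child_value (i \<in> S) i j" if j: "j \<in> children I i" for j
    proof -
      have link: "(j, i) \<in> links I" using j by (simp add: children_def)
      have jp: "j \<in> products I" using link link_products by blast
      have "nprod I - j < nprod I - i"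
        using link_decreasing[OF link] jp by (auto simp: products_def)
      then have "(\<Sum>x\<in>subtree I j. gain I S x) =
          subtree_opt I j (j \<in> S) + (if j \<in> S then 0 else inflow I S j)"
        using less.hyps jp by simp
      moreover have "j \<in> S \<longleftrightarrow>
          \<not> (i \<in> S \<and> subtree_opt I j True < transfer I j i + subtree_opt I j False)"
        using trace[OF jp] link link_unique[OF link] by metis
      ultimately show ?thesis
        by (auto simp: child_value_def inflow_eq[OF link])
    qed
    then have "(\<Sum>x\<in>subtree I i. gain I S x) =
        gain I S i + (\<Sum>j\<in>children I i. child_value (i \<in> S) i j)"
      by (simp add: sum_subtree[OF less.prems])
    then show ?case
      by (auto simp: subtree_opt_rec[OF less.prems] gain_def)
  qed
  have root: "i \<in> products I \<and> i \<in> S" if "i \<in> roots I" for i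
    using that trace by (auto simp: roots_def)
  then show ?thesis
    by (simp add: sum_products mcst_opt_eq_sum_roots subtree_value cong: sum.cong)
qed

end

section \<open>Execution of loops with loop-free bodies\<close>

fun loop_free :: "com \<Rightarrow> bool" where
  "loop_free (NAssign x e a) = True"
| "loop_free (RAssign x e a) = True"
| "loop_free (c ;; d) = (loop_free c \<and> loop_free d)"
| "loop_free (Cond b c d) = (loop_free c \<and> loop_free d)"
| "loop_free (While b c) = False"

text \<open>
  Without loops, execution is a function of the initial state and the number of steps has a bound
  that does not depend on it. The equations for loops, here and in the bound on the steps, are
  placeholders: both functions are meant for loop-free commands.
\<close>

fun final :: "com \<Rightarrow> mem \<Rightarrow> mem" where
  "final (NAssign x e a) s = s\<lparr>nmem := (nmem s)(x := (nmem s x)(nval e s := nval a s))\<rparr>"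
| "final (RAssign x e a) s = s\<lparr>rmem := (rmem s)(x := (rmem s x)(nval e s := rval a s))\<rparr>"
| "final (c ;; d) s = final d (final c s)"
| "final (Cond b c d) s = (if bval b s then final c s else final d s)"
| "final (While b c) s = s"

fun max_steps :: "com \<Rightarrow> nat" where
  "max_steps (NAssign x e a) = 1 + ncost e + ncost a"
| "max_steps (RAssign x e a) = 1 + ncost e + rcost a"
| "max_steps (c ;; d) = 1 + max_steps c + max_steps d"
| "max_steps (Cond b c d) = 1 + bcost b + max (max_steps c) (max_steps d)"
| "max_steps (While b c) = 0"

lemma exec_loop_free:
  assumes "loop_free c"
  shows "\<exists>t\<le>max_steps c. exec c s t (final c s)"
  using assms
proof (induction c arbitrary: s)
  case (NAssign x e a)
  show ?case using exec.NAssign[of x e a s] by auto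
next
  case (RAssign x e a)
  show ?case using exec.RAssign[of x e a s] by auto
next
  case (Seq c d)
  then obtain t u where "t \<le> max_steps c" "exec c s t (final c s)"
    "u \<le> max_steps d" "exec d (final c s) u (final d (final c s))" by force
  then show ?case using exec.Seq by (intro exI[of _ "1 + t + u"]) auto
next
  case (Cond b c d)
  show ?case
  proof (cases "bval b s")
    case True
    obtain t where "t \<le> max_steps c" "exec c s t (final c s)" using Cond by force
    with True show ?thesis using exec.CondTrue by (intro exI[of _ "1 + bcost b + t"]) auto
  next
    case False
    obtain t where "t \<le> max_steps d" "exec d s t (final d s)" using Cond by force
    with False show ?thesis using exec.CondFalse by (intro exI[of _ "1 + bcost b + t"]) auto
  qed
qed simp

text \<open>
  Each of the at most \<open>m s\<close> iterations costs at most \<open>K\<close> steps, and so does the final test.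
\<close>

lemma exec_counting_loop:
  assumes "loop_free c" and "Inv s" and "1 + bcost b + max_steps c \<le> K"
    and step: "\<And>s. Inv s \<Longrightarrow> bval b s \<Longrightarrow> Inv (final c s) \<and> m (final c s) < m s"
  shows "\<exists>t s'. exec (While b c) s t s' \<and> t \<le> K * (m s + 1) \<and> Inv s' \<and> \<not> bval b s'"
  using assms(2)
proof (induction "m s" arbitrary: s rule: less_induct)
  case less
  show ?case
  proof (cases "bval b s")
    case True
    obtain t where t: "t \<le> max_steps c" "exec c s t (final c s)"
      using exec_loop_free[OF assms(1)] by blast
    have dec: "Inv (final c s)" "m (final c s) < m s" using step[OF less.prems True] by auto
    obtain u s' where u: "exec (While b c) (final c s) u s'" "u \<le> K * (m (final c s) + 1)"
      "Inv s'" "\<not> bval b s'"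
      using less.hyps[OF dec(2,1)] by blast
    \<comment> \<open>A decrease of \<open>m\<close> by one pays for one iteration.\<close>
    have "K * (m (final c s) + 1) \<le> K * m s" using dec(2) by (intro mult_le_mono) auto
    then have "1 + bcost b + t + u \<le> K * (m s + 1)"
      using t(1) u(2) assms(3) by (simp add: algebra_simps)
    then show ?thesis using exec.WhileTrue[OF True t(2) u(1)] u(3,4) by blast
  next
    case False
    have "1 + bcost b \<le> K * (m s + 1)" using assms(3) by simp
    then show ?thesis using exec.WhileFalse[OF False] less.prems False by blast
  qed
qed

lemma exec_for_loop:
  assumes "loop_free c0" and "loop_free c" and "Inv (final c0 s)"
    and "1 + max_steps c0 + (1 + bcost b + max_steps c) \<le> K"
    and "m (final c0 s) \<le> n"
    and "\<And>s. Inv s \<Longrightarrow> bval b s \<Longrightarrow> Inv (final c s) \<and> m (final c s) < m s"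
  shows "\<exists>t s'. exec (c0 ;; While b c) s t s' \<and> t \<le> K * (n + 2) \<and> Inv s' \<and> \<not> bval b s'"
proof -
  obtain t where t: "t \<le> max_steps c0" "exec c0 s t (final c0 s)"
    using exec_loop_free[OF assms(1)] by blast
  obtain u s' where u: "exec (While b c) (final c0 s) u s'" "u \<le> K * (m (final c0 s) + 1)"
      "Inv s'" "\<not> bval b s'"
    using exec_counting_loop[OF assms(2), of Inv "final c0 s" b K m] assms by auto
  have "K * (m (final c0 s) + 1) \<le> K * (n + 1)" using assms(5) by (intro mult_le_mono) auto
  with u(2) have "u \<le> K * (n + 1)" by (rule order_trans)
  then have "1 + t + u \<le> K * (n + 2)" using t(1) assms(4) by (simp add: algebra_simps)
  then show ?thesis using exec.Seq[OF t(2) u(1)] u(3,4) by blast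
qed

lemma sum_above_pred:
  fixes f :: "nat \<Rightarrow> real"
  assumes "finite A" "0 < j"
  shows "(\<Sum>c\<in>{c\<in>A. j - 1 < c}. f c) = (if j \<in> A then f j else 0) + (\<Sum>c\<in>{c\<in>A. j < c}. f c)"
proof -
  have "{c\<in>A. j - 1 < c} = (if j \<in> A then {j} else {}) \<union> {c\<in>A. j < c}"
    using assms(2) by (auto, metis Suc_lessI Suc_pred)
  then show ?thesis using assms(1) by auto
qed

section \<open>Reading the instance from memory\<close>

lemma encodes_cong:
  assumes "encodes I s" "nmem s' ''n'' 0 = nmem s ''n'' 0" "nmem s' ''to'' = nmem s ''to''"
    "rmem s' ''r'' = rmem s ''r''" "rmem s' ''lam'' = rmem s ''lam''"
    "rmem s' ''v0'' = rmem s ''v0''" "rmem s' ''w'' = rmem s ''w''"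
  shows "encodes I s'"
  using assms(1) unfolding encodes_def assms(2-) .

context single_link_instance
begin

lemma encodes_link:
  assumes "encodes I s" "(j, k) \<in> links I"
  shows "nmem s ''to'' j = k" "rmem s ''w'' j = wt I j k" "0 < k"
proof -
  have jk: "j \<in> products I" "k \<in> products I" "0 < wt I j k"
    using assms(2) by (auto simp: links_def)
  then have *: "nmem s ''to'' j \<in> products I \<and> 0 < wt I j (nmem s ''to'' j) \<and>
      rmem s ''w'' j = wt I j (nmem s ''to'' j)"
    using assms(1) unfolding encodes_def Let_def by (metis (no_types, lifting))
  then show to: "nmem s ''to'' j = k" using transition_unique jk by blast
  then show "rmem s ''w'' j = wt I j k" using * by simp
  show "0 < k" using jk(2) zero_not_product by (cases k) auto
qed

lemma encodes_price: "encodes I s \<Longrightarrow> j \<in> products I \<Longrightarrow> rmem s ''r'' j = price I j"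
  and encodes_arr: "encodes I s \<Longrightarrow> j \<in> products I \<Longrightarrow> rmem s ''lam'' j = arr I j"
  and encodes_wt_0: "encodes I s \<Longrightarrow> j \<in> products I \<Longrightarrow> rmem s ''v0'' j = wt I j 0"
  and encodes_nprod: "encodes I s \<Longrightarrow> nmem s ''n'' 0 = nprod I"
  by (auto simp: encodes_def)

lemma encodes_to:
  assumes "encodes I s" "j \<in> products I"
  shows "0 < nmem s ''to'' j \<and> rmem s ''r'' j < rmem s ''r'' (nmem s ''to'' j) \<longleftrightarrow>
    (j, nmem s ''to'' j) \<in> links I"
proof
  let ?k = "nmem s ''to'' j"
  assume *: "0 < ?k \<and> rmem s ''r'' j < rmem s ''r'' ?k"
  then have "?k \<in> products I \<and> 0 < wt I j ?k"
    using assms unfolding encodes_def Let_def by (metis (no_types, lifting) less_irrefl)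
  then show "(j, ?k) \<in> links I"
    using * assms encodes_price by (auto simp: links_def)
next
  let ?k = "nmem s ''to'' j"
  assume *: "(j, ?k) \<in> links I"
  then show "0 < ?k \<and> rmem s ''r'' j < rmem s ''r'' ?k"
    using encodes_link(3)[OF assms(1) *] encodes_price[OF assms(1)] by (auto simp: links_def)
qed

lemma bval_has_parent:
  assumes "encodes I s" "j \<in> products I" "nmem s ''j'' 0 = j" "nmem s ''k'' 0 = nmem s ''to'' j"
  shows "bval has_parent s \<longleftrightarrow> (j, nmem s ''to'' j) \<in> links I"
  using encodes_to[OF assms(1,2)] assms(3,4) by (simp add: has_parent_def)

lemma rval_not_offered:
  assumes "encodes I s" "(j, k) \<in> links I" "nmem s ''j'' 0 = j" "nmem s ''k'' 0 = k"
  shows "rval not_offered s = transfer I j k + rmem s ''V0'' j"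
  using assms encodes_link[OF assms(1,2)] link_products[OF assms(2)]
  by (simp add: not_offered_def transfer_def encodes_price encodes_arr encodes_wt_0)

section \<open>Filling the tables\<close>

text \<open>
  The table entry for \<open>i\<close> when the products with index above \<open>j\<close> have been processed.
\<close>

definition partial_value :: "nat \<Rightarrow> bool \<Rightarrow> nat \<Rightarrow> real" where
  "partial_value j b i = (if b then arr I i * price I i else 0) +
     (\<Sum>c\<in>{c \<in> children I i. j < c}. child_value b i c)"

text \<open>
  The children of \<open>i\<close> have larger indices than \<open>i\<close>.
\<close>

lemma partial_value_self:
  assumes "i \<in> products I" "j \<le> i"
  shows "partial_value j b i = subtree_opt I i b"
proof -
  have "{c \<in> children I i. j < c} = children I i"
    using assms(2) link_decreasing by (fastforce simp: children_def)
  then show ?thesis by (simp add: partial_value_def subtree_opt_rec[OF assms(1)])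
qed

lemma partial_value_pred:
  assumes "0 < j"
  shows "partial_value (j - 1) b i =
    (if (j, i) \<in> links I then partial_value j b i + child_value b i j else partial_value j b i)"
  using sum_above_pred[OF finite_children assms] by (simp add: partial_value_def children_def)

text \<open>
  In this and the following time bounds the constants are generous: one iteration of each loop
  takes fewer steps than the factor, which is all that matters for linearity.
\<close>

lemma exec_init_tables:
  assumes "encodes I s"
  shows "\<exists>t s'. exec init_tables s t s' \<and> t \<le> 100 * (nprod I + 2) \<and> encodes I s' \<and>
    (\<forall>x\<in>products I. rmem s' ''V1'' x = arr I x * price I x \<and> rmem s' ''V0'' x = 0)"
proof -
  define Inv where "Inv s \<longleftrightarrow> encodes I s \<and> nmem s ''j'' 0 \<le> nprod I \<and>
    (\<forall>x\<in>products I. nmem s ''j'' 0 < x \<longrightarrow>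
       rmem s ''V1'' x = arr I x * price I x \<and> rmem s ''V0'' x = 0)" for s
  have "\<exists>t s'. exec init_tables s t s' \<and> t \<le> 100 * (nprod I + 2) \<and> Inv s' \<and>
      \<not> bval (NLess (NConst 0) (nvar ''j'')) s'"
    unfolding init_tables_def
  proof (rule exec_for_loop[where m = "\<lambda>s. nmem s ''j'' 0"], goal_cases)
    case 3
    show ?case using assms unfolding Inv_def
      by (auto simp: products_def encodes_nprod elim!: encodes_cong)
  next
    case 5
    show ?case using assms by (simp add: encodes_nprod)
  next
    case (6 s)
    have s: "encodes I s" and j: "0 < nmem s ''j'' 0" "nmem s ''j'' 0 \<in> products I"
      using 6 by (auto simp: Inv_def products_def)
    from 6 j show ?case
      unfolding Inv_def
      by (auto simp: encodes_arr[OF s] encodes_price[OF s] elim!: encodes_cong)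
  qed auto
  then show ?thesis unfolding Inv_def
    by (fastforce simp: products_def)
qed

text \<open>
  The body of the main loop, named so that its effect can be stated on its own.
\<close>

definition fill_body :: com where
  "fill_body =
     (nset ''k'' (NCell ''to'' (nvar ''j'')) ;;
      Cond has_parent
        (Cond (RLess (rcell ''V1'' ''j'') not_offered)
           (RAssign ''V1'' (nvar ''k'') (RAdd (rcell ''V1'' ''k'') not_offered))
           (RAssign ''V1'' (nvar ''k'') (RAdd (rcell ''V1'' ''k'') (rcell ''V1'' ''j''))) ;;
         RAssign ''V0'' (nvar ''k'') (RAdd (rcell ''V0'' ''k'') (rcell ''V1'' ''j'')))
        (RAssign ''opt'' (NConst 0) (RAdd (RCell ''opt'' (NConst 0)) (rcell ''V1'' ''j''))) ;;
      nset ''j'' (NPred (nvar ''j'')))"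

lemma fill_tables_eq:
  "fill_tables = RAssign ''opt'' (NConst 0) RZero ;; nset ''j'' (nvar ''n'') ;;
     While (NLess (NConst 0) (nvar ''j'')) fill_body"
  by (simp add: fill_tables_def fill_body_def)

text \<open>
  In both loops that follow links, the state after loading \<open>to[j]\<close> into \<open>k\<close>. Conditions and
  assignments are evaluated in this state, so it is kept folded when the loop bodies are run.
\<close>

definition load_target :: "mem \<Rightarrow> mem" where
  "load_target s = final (nset ''k'' (NCell ''to'' (nvar ''j''))) s"

lemma load_target:
  assumes "encodes I s"
  shows "encodes I (load_target s)"
    and "nmem (load_target s) =
      (nmem s)(''k'' := (nmem s ''k'')(0 := nmem s ''to'' (nmem s ''j'' 0)))"
    and "rmem (load_target s) = rmem s"
  using assms by (auto simp: load_target_def elim!: encodes_cong)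

lemma bval_has_parent_load_target:
  assumes "encodes I s" "nmem s ''j'' 0 \<in> products I"
  shows "bval has_parent (load_target s) \<longleftrightarrow>
    (nmem s ''j'' 0, nmem s ''to'' (nmem s ''j'' 0)) \<in> links I"
  using bval_has_parent[OF load_target(1)[OF assms(1)] assms(2)]
  by (simp add: load_target(2)[OF assms(1)])

lemma rval_not_offered_load_target:
  assumes "encodes I s" "(nmem s ''j'' 0, k) \<in> links I"
  shows "rval not_offered (load_target s) =
    transfer I (nmem s ''j'' 0) k + rmem s ''V0'' (nmem s ''j'' 0)"
  using rval_not_offered[OF load_target(1)[OF assms(1)] assms(2)] encodes_link[OF assms]
  by (simp add: load_target(2,3)[OF assms(1)])

text \<open>
  A product with a parent adds its terms to the parent's entries. The entries of \<open>j\<close> itself are not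
  overwritten before their last use, as \<open>k\<close> differs from \<open>j\<close>.
\<close>

lemma fill_body_link:
  assumes s: "encodes I s" and link: "(j, k) \<in> links I" and j: "nmem s ''j'' 0 = j"
    and V: "rmem s ''V1'' j = subtree_opt I j True" "rmem s ''V0'' j = subtree_opt I j False"
  shows "nmem (final fill_body s) =
      (nmem s)(''k'' := (nmem s ''k'')(0 := k), ''j'' := (nmem s ''j'')(0 := j - 1))"
    and "rmem (final fill_body s) =
      (rmem s)(''V1'' := (rmem s ''V1'')(k := rmem s ''V1'' k + child_value True k j),
               ''V0'' := (rmem s ''V0'')(k := rmem s ''V0'' k + child_value False k j))"
proof -
  have k: "nmem s ''to'' j = k" "k \<noteq> j"
    using encodes_link[OF s link] link_decreasing[OF link] by auto
  have "bval has_parent (load_target s)"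
    using bval_has_parent_load_target[OF s] j k link link_products by auto
  moreover have "rval not_offered (load_target s) = transfer I j k + subtree_opt I j False"
    using rval_not_offered_load_target[OF s, of k] j link V by simp
  ultimately show "nmem (final fill_body s) =
      (nmem s)(''k'' := (nmem s ''k'')(0 := k), ''j'' := (nmem s ''j'')(0 := j - 1))"
    and "rmem (final fill_body s) =
      (rmem s)(''V1'' := (rmem s ''V1'')(k := rmem s ''V1'' k + child_value True k j),
               ''V0'' := (rmem s ''V0'')(k := rmem s ''V0'' k + child_value False k j))"
    using j k V unfolding fill_body_def final.simps(3) load_target_def[symmetric]
    by (simp_all add: load_target(2,3)[OF s] child_value_def max_def)
qed

lemma fill_body_root:
  assumes s: "encodes I s" and root: "j \<in> roots I" and j: "nmem s ''j'' 0 = j"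
  shows "nmem (final fill_body s) =
      (nmem s)(''k'' := (nmem s ''k'')(0 := nmem s ''to'' j), ''j'' := (nmem s ''j'')(0 := j - 1))"
    and "rmem (final fill_body s) =
      (rmem s)(''opt'' := (rmem s ''opt'')(0 := rmem s ''opt'' 0 + rmem s ''V1'' j))"
proof -
  have "\<not> bval has_parent (load_target s)"
    using bval_has_parent_load_target[OF s] j root by (auto simp: roots_def)
  then show "nmem (final fill_body s) =
      (nmem s)(''k'' := (nmem s ''k'')(0 := nmem s ''to'' j), ''j'' := (nmem s ''j'')(0 := j - 1))"
    and "rmem (final fill_body s) =
      (rmem s)(''opt'' := (rmem s ''opt'')(0 := rmem s ''opt'' 0 + rmem s ''V1'' j))"
    using j unfolding fill_body_def final.simps(3) load_target_def[symmetric]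
    by (simp_all add: load_target(2,3)[OF s])
qed

lemma exec_fill_tables:
  assumes "encodes I s"
    and "\<forall>x\<in>products I. rmem s ''V1'' x = arr I x * price I x \<and> rmem s ''V0'' x = 0"
  shows "\<exists>t s'. exec fill_tables s t s' \<and> t \<le> 200 * (nprod I + 3) \<and> encodes I s' \<and>
    (\<forall>x\<in>products I. rmem s' ''V1'' x = subtree_opt I x True \<and>
       rmem s' ''V0'' x = subtree_opt I x False) \<and>
    rmem s' ''opt'' 0 = mcst_opt I"
proof -
  define Inv where "Inv s \<longleftrightarrow> encodes I s \<and> nmem s ''j'' 0 \<le> nprod I \<and>
    (\<forall>x\<in>products I. rmem s ''V1'' x = partial_value (nmem s ''j'' 0) True x \<and>
       rmem s ''V0'' x = partial_value (nmem s ''j'' 0) False x) \<and>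
    rmem s ''opt'' 0 = (\<Sum>c\<in>{c \<in> roots I. nmem s ''j'' 0 < c}. subtree_opt I c True)" for s
  have step: "Inv (final fill_body s) \<and> nmem (final fill_body s) ''j'' 0 < nmem s ''j'' 0"
    if "Inv s" "0 < nmem s ''j'' 0" for s
  proof -
    define j where "j = nmem s ''j'' 0"
    have s: "encodes I s" and j: "0 < j" "j \<in> products I" "nmem s ''j'' 0 = j" "j \<le> nprod I"
      and tab: "\<And>x. x \<in> products I \<Longrightarrow> rmem s ''V1'' x = partial_value j True x"
        "\<And>x. x \<in> products I \<Longrightarrow> rmem s ''V0'' x = partial_value j False x"
      and opt: "rmem s ''opt'' 0 = (\<Sum>c\<in>{c \<in> roots I. j < c}. subtree_opt I c True)"
      using that by (auto simp: Inv_def products_def j_def)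
    have V: "rmem s ''V1'' j = subtree_opt I j True" "rmem s ''V0'' j = subtree_opt I j False"
      using tab j by (auto simp: partial_value_self)
    note pred = sum_above_pred[OF finite_roots j(1)] partial_value_pred[OF j(1)]
    show ?thesis
    proof (cases "j \<in> roots I")
      case True
      note upd = fill_body_root[OF s True j(3)]
      have "encodes I (final fill_body s)" by (rule encodes_cong[OF s]) (simp_all add: upd)
      moreover have "(j, k) \<notin> links I" for k using True by (simp add: roots_def)
      ultimately show ?thesis
        using True j V unfolding Inv_def
        by (auto simp: upd pred tab opt simp del: One_nat_def)
    next
      case False
      then obtain k where link: "(j, k) \<in> links I" using j by (auto simp: roots_def)
      note upd = fill_body_link[OF s link j(3) V]
      have "encodes I (final fill_body s)" by (rule encodes_cong[OF s]) (simp_all add: upd)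
      moreover have "(j, x) \<in> links I \<longleftrightarrow> x = k" for x using link link_unique by blast
      ultimately show ?thesis
        using False j unfolding Inv_def
        by (simp add: upd pred tab opt del: One_nat_def)
    qed
  qed
  let ?s = "s\<lparr>rmem := (rmem s)(''opt'' := (rmem s ''opt'')(0 := 0))\<rparr>"
  have s: "encodes I ?s" using assms(1) by (auto elim!: encodes_cong)
  have none: "{c \<in> roots I. nprod I < c} = {}" "{c \<in> children I i. nprod I < c} = {}" for i
    using link_products by (fastforce simp: roots_def products_def children_def)+
  obtain t s' where t: "exec (nset ''j'' (nvar ''n'') ;;
      While (NLess (NConst 0) (nvar ''j'')) fill_body) ?s t s'"
    "t \<le> 200 * (nprod I + 2)" "Inv s'" "\<not> bval (NLess (NConst 0) (nvar ''j'')) s'"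
  proof (atomize_elim, rule exec_for_loop[where m = "\<lambda>s. nmem s ''j'' 0"], goal_cases)
    case 3
    have "encodes I (final (nset ''j'' (nvar ''n'')) ?s)"
      using s by (auto elim!: encodes_cong)
    then show ?case using assms unfolding Inv_def
      by (auto simp: encodes_nprod partial_value_def none)
  next
    case (6 s)
    then show ?case using step by simp
  qed (use assms in \<open>simp_all add: encodes_nprod fill_body_def has_parent_def not_offered_def\<close>)
  have "exec fill_tables s (1 + 3 + t) s'"
    unfolding fill_tables_eq using exec.RAssign[of "''opt''" "NConst 0" RZero s] t(1)
    by (intro exec.Seq) (auto simp: numeral_eq_Suc)
  moreover have "1 + 3 + t \<le> 200 * (nprod I + 3)" using t(2) by simp
  moreover have "{c \<in> roots I. 0 < c} = roots I"
    using zero_not_product by (auto simp: roots_def intro: gr0I)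
  then have "rmem s' ''opt'' 0 = mcst_opt I"
    using t(3,4) by (simp add: Inv_def mcst_opt_eq_sum_roots)
  ultimately show ?thesis
    using t(3,4) unfolding Inv_def by (auto simp: partial_value_self intro!: exI)
qed

section \<open>Reading off the assortment\<close>

definition trace_body :: com where
  "trace_body =
     (nset ''k'' (NCell ''to'' (nvar ''j'')) ;;
      Cond (BAnd (BAnd has_parent (NLess (NConst 0) (NCell ''sel'' (nvar ''k''))))
                 (RLess (rcell ''V1'' ''j'') not_offered))
        (NAssign ''sel'' (nvar ''j'') (NConst 0))
        (NAssign ''sel'' (nvar ''j'') (NConst 1)) ;;
      nset ''j'' (NSucc (nvar ''j'')))"

lemma trace_back_eq:
  "trace_back = nset ''j'' (NConst 1) ;;
     While (NLess (nvar ''j'') (NSucc (nvar ''n''))) trace_body"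
  by (simp add: trace_back_def trace_body_def)

text \<open>
  The tracing rule: \<open>j\<close> is left out if its parent is offered and the maximum for \<open>j\<close> is attained only
  by not offering \<open>j\<close>.
\<close>

definition left_out :: "(nat \<Rightarrow> bool) \<Rightarrow> nat \<Rightarrow> bool" where
  "left_out offered j \<longleftrightarrow> (\<exists>k. (j, k) \<in> links I \<and> offered k \<and>
     subtree_opt I j True < transfer I j k + subtree_opt I j False)"

lemma trace_body:
  assumes s: "encodes I s" and jp: "j \<in> products I" and j: "nmem s ''j'' 0 = j"
    and V: "rmem s ''V1'' j = subtree_opt I j True" "rmem s ''V0'' j = subtree_opt I j False"
  shows "nmem (final trace_body s) =
      (nmem s)(''k'' := (nmem s ''k'')(0 := nmem s ''to'' j),
        ''sel'' := (nmem s ''sel'')(j := if left_out (\<lambda>k. 0 < nmem s ''sel'' k) j then 0 else 1),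
        ''j'' := (nmem s ''j'')(0 := j + 1))"
    and "rmem (final trace_body s) = rmem s"
proof -
  let ?k = "nmem s ''to'' j"
  have parent: "bval has_parent (load_target s) \<longleftrightarrow> (j, ?k) \<in> links I"
    using bval_has_parent_load_target[OF s] j jp by simp
  have no: "rval not_offered (load_target s) = transfer I j ?k + subtree_opt I j False"
    if "(j, ?k) \<in> links I"
    using rval_not_offered_load_target[OF s, of ?k] j that V by simp
  have "left_out (\<lambda>k. 0 < nmem s ''sel'' k) j \<longleftrightarrow> (j, ?k) \<in> links I \<and> 0 < nmem s ''sel'' ?k \<and>
      subtree_opt I j True < transfer I j ?k + subtree_opt I j False"
    using encodes_link(1)[OF s] by (auto simp: left_out_def)
  then have cond: "bval (BAnd (BAnd has_parent (NLess (NConst 0) (NCell ''sel'' (nvar ''k''))))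
                 (RLess (rcell ''V1'' ''j'') not_offered)) (load_target s) \<longleftrightarrow>
      left_out (\<lambda>k. 0 < nmem s ''sel'' k) j"
    using parent no j V by (auto simp: load_target(2,3)[OF s])
  show "nmem (final trace_body s) =
      (nmem s)(''k'' := (nmem s ''k'')(0 := nmem s ''to'' j),
        ''sel'' := (nmem s ''sel'')(j := if left_out (\<lambda>k. 0 < nmem s ''sel'' k) j then 0 else 1),
        ''j'' := (nmem s ''j'')(0 := j + 1))"
    and "rmem (final trace_body s) = rmem s"
    using j unfolding trace_body_def final.simps(3,4) load_target_def[symmetric] cond
    by (simp_all add: load_target(2,3)[OF s])
qed

text \<open>
  Parents are decided before their children, so a decision depends only on entries that no later
  step changes. This turns the sequence of decisions into a fixed-point equation for the final
  \<open>sel\<close> array.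
\<close>

lemma exec_trace_back:
  assumes "encodes I s"
    and "\<forall>x\<in>products I. rmem s ''V1'' x = subtree_opt I x True \<and>
       rmem s ''V0'' x = subtree_opt I x False"
  shows "\<exists>t s'. exec trace_back s t s' \<and> t \<le> 200 * (nprod I + 2) \<and> encodes I s' \<and>
    rmem s' = rmem s \<and>
    (\<forall>x\<in>products I. nmem s' ''sel'' x = (if left_out (\<lambda>k. 0 < nmem s' ''sel'' k) x then 0 else 1))"
proof -
  define Inv where "Inv s' \<longleftrightarrow> encodes I s' \<and> 1 \<le> nmem s' ''j'' 0 \<and> rmem s' = rmem s \<and>
    (\<forall>x\<in>products I. x < nmem s' ''j'' 0 \<longrightarrow>
      nmem s' ''sel'' x = (if left_out (\<lambda>k. 0 < nmem s' ''sel'' k) x then 0 else 1))" for s'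
  have step: "Inv (final trace_body s') \<and>
      nprod I + 1 - nmem (final trace_body s') ''j'' 0 < nprod I + 1 - nmem s' ''j'' 0"
    if "Inv s'" "nmem s' ''j'' 0 < nmem s' ''n'' 0 + 1" for s'
  proof -
    define j where "j = nmem s' ''j'' 0"
    have s: "encodes I s'" and r: "rmem s' = rmem s" using that by (auto simp: Inv_def)
    have j: "j \<in> products I" "nmem s' ''j'' 0 = j" "j \<le> nprod I"
      using that encodes_nprod[OF s] by (auto simp: Inv_def products_def j_def)
    have sel: "nmem s' ''sel'' x = (if left_out (\<lambda>k. 0 < nmem s' ''sel'' k) x then 0 else 1)"
      if "x \<in> products I" "x < j" for x
      using \<open>Inv s'\<close> that by (simp add: Inv_def j_def)
    note upd = trace_body[OF s j(1,2)]
    have V: "rmem s' ''V1'' j = subtree_opt I j True" "rmem s' ''V0'' j = subtree_opt I j False"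
      using assms(2) j r by auto
    have enc: "encodes I (final trace_body s')"
      by (rule encodes_cong[OF s]) (simp_all add: upd[OF V])
    \<comment> \<open>Changing \<open>sel[j]\<close> does not affect decisions up to \<open>j\<close>, which look only at smaller indices.\<close>
    have local: "left_out (\<lambda>k. 0 < ((nmem s' ''sel'')(j := v)) k) x \<longleftrightarrow>
        left_out (\<lambda>k. 0 < nmem s' ''sel'' k) x" if "x \<le> j" for x v
      using that link_decreasing by (fastforce simp: left_out_def)
    have "nmem (final trace_body s') ''sel'' x =
        (if left_out (\<lambda>k. 0 < nmem (final trace_body s') ''sel'' k) x then 0 else 1)"
      if "x \<in> products I" "x < j + 1" for x
      using that sel[of x] local[of x] by (cases "x = j") (auto simp: upd[OF V] simp del: fun_upd_apply, auto)
    then show ?thesis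
      using enc j r by (simp add: Inv_def upd[OF V])
  qed
  have "\<exists>t s'. exec trace_back s t s' \<and> t \<le> 200 * (nprod I + 2) \<and> Inv s' \<and>
      \<not> bval (NLess (nvar ''j'') (NSucc (nvar ''n''))) s'"
    unfolding trace_back_eq
  proof (rule exec_for_loop[where m = "\<lambda>s'. nprod I + 1 - nmem s' ''j'' 0"], goal_cases)
    case 3
    have "encodes I (final (nset ''j'' (NConst 1)) s)"
      using assms(1) by (auto elim!: encodes_cong)
    then show ?case unfolding Inv_def by (auto simp: products_def)
  next
    case (6 s)
    then show ?case using step by simp
  qed (simp_all add: trace_body_def has_parent_def not_offered_def)
  then show ?thesis
    unfolding Inv_def by (fastforce simp: products_def encodes_nprod)
qed

text \<open>
  Every product left out has an offered parent, which \<open>to[j]\<close> then is; so the singleton recommended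
  in memory is feasible and agrees with \<open>parents_in\<close> on the products left out.
\<close>

lemma offered_optimal:
  assumes "encodes I s"
    and sel: "\<forall>x\<in>products I. nmem s ''sel'' x = (if left_out (\<lambda>k. 0 < nmem s ''sel'' k) x then 0 else 1)"
  shows "feasible (products I) (out_offered I s) (out_recommended s)"
    and "revenue I (products I) (wt I) (out_offered I s) (out_recommended s) = mcst_opt I"
proof -
  let ?S = "out_offered I s"
  have pos: "0 < nmem s ''sel'' k \<longleftrightarrow> k \<in> ?S" if "k \<in> products I" for k
    using sel that by (auto simp: out_offered_def)
  have S: "?S \<subseteq> products I" by (auto simp: out_offered_def)
  have trace: "j \<in> ?S \<longleftrightarrow> \<not> (\<exists>k\<in>?S. (j, k) \<in> links I \<and>
      subtree_opt I j True < transfer I j k + subtree_opt I j False)" if "j \<in> products I" for j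
  proof -
    have "j \<in> ?S \<longleftrightarrow> \<not> left_out (\<lambda>k. 0 < nmem s ''sel'' k) j"
      using sel that by (auto simp: out_offered_def)
    then show ?thesis using pos link_products unfolding left_out_def by blast
  qed
  have rec: "out_recommended s j = parents_in I ?S j" if j: "j \<in> products I - ?S" for j
  proof -
    obtain k where k: "k \<in> ?S" "(j, k) \<in> links I" using trace j by blast
    then show ?thesis
      using encodes_link(1)[OF assms(1) k(2)]
      by (simp add: out_recommended_def parents_in_eq[OF k(2)])
  qed
  show "feasible (products I) ?S (out_recommended s)"
    using feasible_parents_in[OF S] rec by (simp add: feasible_def)
  have "revenue I (products I) (wt I) ?S (out_recommended s) =
      revenue I (products I) (wt I) ?S (parents_in I ?S)"
    unfolding revenue_def by (simp add: rec)
  also have "\<dots> = (\<Sum>x\<in>products I. gain I ?S x)"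
    using S by (intro revenue_recommend_parent) auto
  also have "\<dots> = mcst_opt I" using trace by (rule traced_assortment_optimal)
  finally show "revenue I (products I) (wt I) ?S (out_recommended s) = mcst_opt I" .
qed

section \<open>Correctness and linear running time of the program\<close>

lemma exec_mcst_dp:
  assumes "encodes I s"
  shows "\<exists>t s'. exec mcst_dp s t s' \<and> t \<le> 500 * (nprod I + 3) \<and>
    (\<forall>i\<in>products I. rmem s' ''V1'' i = subtree_opt I i True \<and>
       rmem s' ''V0'' i = subtree_opt I i False) \<and>
    rmem s' ''opt'' 0 = mcst_opt I \<and>
    feasible (products I) (out_offered I s') (out_recommended s') \<and>
    revenue I (products I) (wt I) (out_offered I s') (out_recommended s') = mcst_opt I"
proof -
  obtain t1 s1 where 1: "exec init_tables s t1 s1" "t1 \<le> 100 * (nprod I + 2)" "encodes I s1"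
    "\<forall>x\<in>products I. rmem s1 ''V1'' x = arr I x * price I x \<and> rmem s1 ''V0'' x = 0"
    using exec_init_tables[OF assms] by blast
  obtain t2 s2 where 2: "exec fill_tables s1 t2 s2" "t2 \<le> 200 * (nprod I + 3)" "encodes I s2"
    "\<forall>x\<in>products I. rmem s2 ''V1'' x = subtree_opt I x True \<and>
       rmem s2 ''V0'' x = subtree_opt I x False" "rmem s2 ''opt'' 0 = mcst_opt I"
    using exec_fill_tables[OF 1(3,4)] by blast
  obtain t3 s3 where 3: "exec trace_back s2 t3 s3" "t3 \<le> 200 * (nprod I + 2)" "encodes I s3"
    "rmem s3 = rmem s2"
    "\<forall>x\<in>products I. nmem s3 ''sel'' x = (if left_out (\<lambda>k. 0 < nmem s3 ''sel'' k) x then 0 else 1)"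
    using exec_trace_back[OF 2(3,4)] by blast
  have "exec mcst_dp s (1 + t1 + (1 + t2 + t3)) s3"
    unfolding mcst_dp_def by (rule exec.Seq[OF 1(1) exec.Seq[OF 2(1) 3(1)]])
  moreover have "1 + t1 + (1 + t2 + t3) \<le> 500 * (nprod I + 3)"
    using 1(2) 2(2) 3(2) by simp
  ultimately show ?thesis
    using 2(4,5) 3(4) offered_optimal[OF 3(3,5)] by metis
qed

end

theorem theorem4:
  shows
    "(\<forall>I. valid_mcst I \<and> single_link I \<longrightarrow>
        (\<forall>(j, k)\<in>links I. k < j) \<and>
        (\<forall>i\<in>products I. children I i = {} \<longrightarrow>
           subtree_opt I i True = arr I i * price I i \<and>
           subtree_opt I i False = 0) \<and>
        (\<forall>i\<in>products I. children I i \<noteq> {} \<longrightarrow>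
           subtree_opt I i True = arr I i * price I i +
             (\<Sum>j\<in>children I i.
                max (subtree_opt I j True)
                    (arr I j * wt I j i * price I i / (wt I j i + wt I j 0)
                       + subtree_opt I j False)) \<and>
           subtree_opt I i False = (\<Sum>j\<in>children I i. subtree_opt I j True)) \<and>
        mcst_opt I = (\<Sum>i\<in>roots I. subtree_opt I i True) \<and>
        ((\<forall>i\<in>products I. (i, 1) \<in> (links I)\<^sup>*) \<longrightarrow> mcst_opt I = subtree_opt I 1 True)) \<and>
     (\<exists>T :: nat \<Rightarrow> nat.
        (\<lambda>n. real (T n)) \<in> O(\<lambda>n. real n) \<and>
        (\<forall>I s. valid_mcst I \<and> single_link I \<and> encodes I s \<longrightarrow>
           (\<exists>t s'. exec mcst_dp s t s' \<and> t \<le> T (nprod I) \<and>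
              (\<forall>i\<in>products I.
                 rmem s' ''V1'' i = subtree_opt I i True \<and>
                 rmem s' ''V0'' i = subtree_opt I i False) \<and>
              rmem s' ''opt'' 0 = mcst_opt I \<and>
              feasible (products I) (out_offered I s') (out_recommended s') \<and>
              revenue I (products I) (wt I) (out_offered I s') (out_recommended s')
                = mcst_opt I)))"
proof (intro conjI[OF allI exI[of _ "\<lambda>n. 500 * (n + 3)"]] conjI impI allI)
  fix I assume "valid_mcst I \<and> single_link I"
  then interpret single_link_instance I by unfold_locales auto
  show "\<forall>(j, k)\<in>links I. k < j" using link_decreasing by blast
  show "\<forall>i\<in>products I. children I i = {} \<longrightarrow>
      subtree_opt I i True = arr I i * price I i \<and> subtree_opt I i False = 0"
    by (simp add: subtree_opt_rec)
  show "\<forall>i\<in>products I. children I i \<noteq> {} \<longrightarrow>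
      subtree_opt I i True = arr I i * price I i +
        (\<Sum>j\<in>children I i.
           max (subtree_opt I j True)
               (arr I j * wt I j i * price I i / (wt I j i + wt I j 0) + subtree_opt I j False)) \<and>
      subtree_opt I i False = (\<Sum>j\<in>children I i. subtree_opt I j True)"
    using subtree_opt_rec[of _ True] subtree_opt_rec[of _ False]
    by (simp add: child_value_def transfer_def)
  show "mcst_opt I = (\<Sum>i\<in>roots I. subtree_opt I i True)" by (rule mcst_opt_eq_sum_roots)
  show "mcst_opt I = subtree_opt I 1 True" if "\<forall>i\<in>products I. (i, 1) \<in> (links I)\<^sup>*"
    using roots_of_tree[OF that] by (simp add: mcst_opt_eq_sum_roots)
next
  show "(\<lambda>n. real (500 * (n + 3))) \<in> O(\<lambda>n. real n)"
  proof (rule bigoI[of _ 2000])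
    show "\<forall>\<^sub>F n in sequentially. norm (real (500 * (n + 3))) \<le> 2000 * norm (real n)"
      using eventually_ge_at_top[of 1] by eventually_elim simp
  qed
next
  fix I s assume *: "valid_mcst I \<and> single_link I \<and> encodes I s"
  then interpret single_link_instance I by unfold_locales auto
  show "\<exists>t s'. exec mcst_dp s t s' \<and> t \<le> 500 * (nprod I + 3) \<and>
    (\<forall>i\<in>products I. rmem s' ''V1'' i = subtree_opt I i True \<and>
       rmem s' ''V0'' i = subtree_opt I i False) \<and>
    rmem s' ''opt'' 0 = mcst_opt I \<and>
    feasible (products I) (out_offered I s') (out_recommended s') \<and>
    revenue I (products I) (wt I) (out_offered I s') (out_recommended s') = mcst_opt I"
    using * by (intro exec_mcst_dp) simp
qed

end
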